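(* Let $D$ be a locally special double poset on a finite set $N$ and let $\mathfrak{G}\subseteq\operatorname{Aut}(D)$. Then $(-1)^{|N|}\operatorname{sgn}\cdot S\,\Omega(D,\mathfrak{G},\mathbf{x})=\Omega(D^{*},\mathfrak{G},\mathbf{x})$, i.e. for every $\mathfrak{g}\in\mathfrak{G}$, $(-1)^{|N|}\operatorname{sgn}(\mathfrak{g})\,S\big(\Omega(D,\mathfrak{G},\mathbf{x};\mathfrak{g})\big)=\Omega(D^{*},\mathfrak{G},\mathbf{x};\mathfrak{g})$. Also $(-1)^{|N|}\operatorname{sgn}(\mathfrak{g})\,\Omega(D,\mathfrak{G},-x;\mathfrak{g})=\Omega(D^*,\mathfrak{G},x;\mathfrak{g})$ for all $\mathfrak{g}\in\mathfrak{G}$.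
   Context: Double poset $D=(N,\le_1,\le_2)$; locally special: whenever $y$ covers $x$ in $\le_1$, $x$ and $y$ are $\le_2$-comparable. $D^*$ is the double poset obtained from $D$ by reversing $\le_1$ (keeping $\le_2$); note $\operatorname{Aut}(D^* )=\operatorname{Aut}(D)$ (bijections preserving both orders). A $D$-partition is $f:N\to\{1,2,\dots\}$ with $i\le_1 j\Rightarrow f(i)\le f(j)$ and ($i<_1j$ and $j<_2 i$) $\Rightarrow f(i)<f(j)$. $\Omega(D,\mathfrak{G},\mathbf{x};\mathfrak{g})=\sum_f\prod_{v\in N}x_{f(v)}$ over $D$-partitions with $f\circ\mathfrak{g}=f$; $\Omega(D,\mathfrak{G},x;\mathfrak{g})$ is the polynomial in $x$ whose value at each positive integer $n$ is the number of such $f$ with values in $\{1,\dots,n\}$. $\operatorname{sgn}(\mathfrak{g})$ is the sign of $\mathfrak{g}$ as a permutation of $N$. $S$ is the antipode of the Hopf algebra of quasisymmetric functions: $S(M_\alpha)=(-1)^{\ell(\alpha)}\sum_{\beta\le\alpha}M_{\overleftarrow{\beta}}$, where $\ell(\alpha)$ is the number of parts, $\beta\le\alpha$ means $\alpha$ refines $\beta$, and $\overleftarrow\beta$ is $\beta$ reversed. *)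

theory Defs
  imports
    "HOL-Library.Multiset"
    "HOL-Library.FuncSet"
    "HOL-Library.Infinite_Set"
    "HOL-Combinatorics.Permutations"
    "HOL-Computational_Algebra.Polynomial"
begin

section \<open>Double posets\<close>

record 'a double_poset =
  points :: "'a set"
  ord1 :: "'a rel"
  ord2 :: "'a rel"

definition double_poset :: "'a double_poset \<Rightarrow> bool" where
  "double_poset D \<longleftrightarrow>
     partial_order_on (points D) (ord1 D) \<and> partial_order_on (points D) (ord2 D)"

definition less1 :: "'a double_poset \<Rightarrow> 'a \<Rightarrow> 'a \<Rightarrow> bool" where
  "less1 D x y \<longleftrightarrow> (x, y) \<in> ord1 D \<and> x \<noteq> y"

definition less2 :: "'a double_poset \<Rightarrow> 'a \<Rightarrow> 'a \<Rightarrow> bool" where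
  "less2 D x y \<longleftrightarrow> (x, y) \<in> ord2 D \<and> x \<noteq> y"

definition covers1 :: "'a double_poset \<Rightarrow> 'a \<Rightarrow> 'a \<Rightarrow> bool" where
  "covers1 D y x \<longleftrightarrow> less1 D x y \<and> \<not> (\<exists>z. less1 D x z \<and> less1 D z y)"

definition locally_special :: "'a double_poset \<Rightarrow> bool" where
  "locally_special D \<longleftrightarrow>
     (\<forall>x y. covers1 D y x \<longrightarrow> (x, y) \<in> ord2 D \<or> (y, x) \<in> ord2 D)"

definition dual :: "'a double_poset \<Rightarrow> 'a double_poset" where
  "dual D = D\<lparr>ord1 := (ord1 D)\<inverse>\<rparr>"

text \<open>Automorphisms are permutations of the whole type that fix every element outside
  \<open>points D\<close>; hence \<^const>\<open>sign\<close> of an automorphism is its sign as a permutation of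
  \<open>points D\<close>.\<close>

definition Aut :: "'a double_poset \<Rightarrow> ('a \<Rightarrow> 'a) set" where
  "Aut D = {g. g permutes points D \<and>
     (\<forall>x\<in>points D. \<forall>y\<in>points D.
        ((g x, g y) \<in> ord1 D \<longleftrightarrow> (x, y) \<in> ord1 D) \<and>
        ((g x, g y) \<in> ord2 D \<longleftrightarrow> (x, y) \<in> ord2 D))}"

lemma Aut_dual: "Aut (dual D) = Aut D"
  by (auto simp: Aut_def dual_def)


section \<open>D-partitions\<close>

text \<open>Maps defined on \<open>points D\<close> only are represented by extensional functions.\<close>

definition D_partitions :: "'a double_poset \<Rightarrow> ('a \<Rightarrow> nat) set" where
  "D_partitions D = {f \<in> points D \<rightarrow>\<^sub>E {1..}.
     (\<forall>i j. (i, j) \<in> ord1 D \<longrightarrow> f i \<le> f j) \<and>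
     (\<forall>i j. less1 D i j \<and> less2 D j i \<longrightarrow> f i < f j)}"

definition fixed_D_partitions :: "'a double_poset \<Rightarrow> ('a \<Rightarrow> 'a) \<Rightarrow> ('a \<Rightarrow> nat) set" where
  "fixed_D_partitions D g = {f \<in> D_partitions D. f \<circ> g = f}"


section \<open>Quasisymmetric functions\<close>

text \<open>A formal power series in \<open>x\<^sub>1, x\<^sub>2, \<dots>\<close> is represented by its coefficient function;
  the monomial \<open>x\<^sub>i\<^sub>1 \<cdots> x\<^sub>i\<^sub>r\<close> is the multiset \<open>{#i\<^sub>1, \<dots>, i\<^sub>r#}\<close>. There is no variable
  \<open>x\<^sub>0\<close>, so monomials containing \<open>0\<close> have coefficient \<open>0\<close>.\<close>

type_synonym 'k series = "nat multiset \<Rightarrow> 'k"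

definition composition :: "nat list \<Rightarrow> bool" where
  "composition \<alpha> \<longleftrightarrow> (\<forall>a\<in>set \<alpha>. 0 < a)"

text \<open>The list of nonzero exponents of a monomial, in increasing order of the variables.\<close>

definition exponents :: "nat multiset \<Rightarrow> nat list" where
  "exponents m = map (count m) (sorted_list_of_set (set_mset m))"

definition QSym :: "('k::field_char_0) series set" where
  "QSym = {F. (\<exists>d. \<forall>m. F m \<noteq> 0 \<longrightarrow> size m \<le> d) \<and>
     (\<forall>m. 0 \<in># m \<longrightarrow> F m = 0) \<and>
     (\<forall>m m'. 0 \<notin># m \<and> 0 \<notin># m' \<and> exponents m = exponents m' \<longrightarrow> F m = F m')}"

definition M :: "nat list \<Rightarrow> ('k::field_char_0) series" where
  "M \<alpha> = (\<lambda>m. if 0 \<notin># m \<and> exponents m = \<alpha> then 1 else 0)"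

text \<open>For \<open>\<alpha> = (a\<^sub>1, \<dots>, a\<^sub>k)\<close>, the monomial whose exponent of \<open>x\<^sub>i\<close> is \<open>a\<^sub>i\<close>.\<close>

definition packed :: "nat list \<Rightarrow> nat multiset" where
  "packed \<alpha> = (\<Sum>i<length \<alpha>. replicate_mset (\<alpha> ! i) (Suc i))"

text \<open>The coefficient of \<open>M \<alpha>\<close> in a quasisymmetric function; see \<open>QSym_expansion\<close>.\<close>

definition M_coeff :: "('k::field_char_0) series \<Rightarrow> nat list \<Rightarrow> 'k" where
  "M_coeff F \<alpha> = F (packed \<alpha>)"

text \<open>\<open>\<alpha>\<close> refines \<open>\<beta>\<close>: the parts of \<open>\<beta>\<close> are the sums of consecutive nonempty blocks of \<open>\<alpha>\<close>.\<close>

definition refines :: "nat list \<Rightarrow> nat list \<Rightarrow> bool" where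
  "refines \<alpha> \<beta> \<longleftrightarrow> (\<exists>bs. [] \<notin> set bs \<and> concat bs = \<alpha> \<and> map sum_list bs = \<beta>)"

definition antipode_M :: "nat list \<Rightarrow> ('k::field_char_0) series" where
  "antipode_M \<alpha> = (\<lambda>m. (-1) ^ length \<alpha> *
     (\<Sum>\<beta> | composition \<beta> \<and> refines \<alpha> \<beta>. M (rev \<beta>) m))"

text \<open>The linear extension of \<^const>\<open>antipode_M\<close>. On \<^const>\<open>QSym\<close> the index set of the
  sum is finite, see \<open>finite_M_support\<close>.\<close>

definition antipode :: "('k::field_char_0) series \<Rightarrow> 'k series" where
  "antipode F = (\<lambda>m. \<Sum>\<alpha> | composition \<alpha> \<and> M_coeff F \<alpha> \<noteq> 0.
     M_coeff F \<alpha> * antipode_M \<alpha> m)"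


section \<open>The quasisymmetric and polynomial invariants\<close>

text \<open>The monomial \<open>\<Prod>v\<in>N. x\<^bsub>f v\<^esub>\<close>.\<close>

definition monomial_of :: "'a double_poset \<Rightarrow> ('a \<Rightarrow> nat) \<Rightarrow> nat multiset" where
  "monomial_of D f = image_mset f (mset_set (points D))"

definition Omega :: "'a double_poset \<Rightarrow> ('a \<Rightarrow> 'a) \<Rightarrow> ('k::field_char_0) series" where
  "Omega D g = (\<lambda>m. of_nat (card {f \<in> fixed_D_partitions D g. monomial_of D f = m}))"

text \<open>Existence and uniqueness of this polynomial are shown in \<open>Omega_poly_eval\<close> and
  \<open>Omega_poly_unique\<close>.\<close>

definition Omega_poly :: "'a double_poset \<Rightarrow> ('a \<Rightarrow> 'a) \<Rightarrow> ('k::field_char_0) poly" where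
  "Omega_poly D g = (THE p. \<forall>n\<ge>1. poly p (of_nat n) =
     of_nat (card {f \<in> fixed_D_partitions D g. f ` points D \<subseteq> {1..n}}))"


section \<open>Well-definedness\<close>

lemma sorted_list_of_set_image_strict_mono:
  fixes A :: "nat set"
  assumes "finite A" "strict_mono_on A h"
  shows "sorted_list_of_set (h ` A) = map h (sorted_list_of_set A)"
proof (rule sorted_distinct_set_unique)
  have inj: "inj_on h A" using assms(2) by (rule strict_mono_on_imp_inj_on)
  show "sorted (map h (sorted_list_of_set A))"
    by (rule sorted_map_mono) (use assms strict_mono_on_imp_mono_on in auto)
  show "distinct (map h (sorted_list_of_set A))"
    using assms inj by (simp add: distinct_map)
qed (use assms in auto)

lemma exponents_image_mset:
  assumes "strict_mono_on A h" "set_mset m \<subseteq> A"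
  shows "exponents (image_mset h m) = exponents m"
proof -
  have mono: "strict_mono_on (set_mset m) h"
    using assms by (auto simp: strict_mono_on_def)
  have inj: "inj_on h (set_mset m)" using mono by (rule strict_mono_on_imp_inj_on)
  have "count (image_mset h m) (h x) = count m x" if "x \<in># m" for x
  proof -
    have "h -` {h x} \<inter> set_mset m = {x}" using inj that by (auto dest: inj_onD)
    then show ?thesis by (simp add: count_image_mset)
  qed
  then show ?thesis
    using mono by (simp add: exponents_def sorted_list_of_set_image_strict_mono)
qed

lemma count_packed:
  "count (packed \<alpha>) j = (if 1 \<le> j \<and> j \<le> length \<alpha> then \<alpha> ! (j - 1) else 0)"
proof -
  have "count (packed \<alpha>) j = (\<Sum>i<length \<alpha>. if j = Suc i then \<alpha> ! i else 0)"
    by (simp add: packed_def count_sum eq_commute)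
  also have "\<dots> = (\<Sum>i<length \<alpha>. if i = j - 1 then (if j \<ge> 1 then \<alpha> ! i else 0) else 0)"
    by (rule sum.cong) auto
  also have "\<dots> = (if 1 \<le> j \<and> j \<le> length \<alpha> then \<alpha> ! (j - 1) else 0)"
    by auto
  finally show ?thesis .
qed

lemma set_packed:
  assumes "composition \<alpha>" shows "set_mset (packed \<alpha>) = {1..length \<alpha>}"
proof -
  have "0 < \<alpha> ! (j - 1)" if "1 \<le> j" "j \<le> length \<alpha>" for j
    using assms that by (simp add: composition_def)
  then show ?thesis by (force simp: set_mset_def count_packed)
qed

lemma exponents_packed:
  assumes "composition \<alpha>" shows "exponents (packed \<alpha>) = \<alpha>"
proof -
  have "exponents (packed \<alpha>) = map (count (packed \<alpha>)) [Suc 0..<Suc (length \<alpha>)]"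
    using assms by (simp add: exponents_def set_packed
        atLeastLessThanSuc_atLeastAtMost[symmetric] del: upt_Suc)
  also have "\<dots> = \<alpha>"
    by (rule nth_equalityI) (auto simp: count_packed simp del: upt_Suc)
  finally show ?thesis .
qed

lemma zero_not_in_packed: "0 \<notin># packed \<alpha>"
  by (simp add: count_packed not_in_iff)

lemma composition_exponents: "composition (exponents m)"
  by (auto simp: composition_def exponents_def)

lemma size_packed: "size (packed \<alpha>) = sum_list \<alpha>"
  by (simp add: packed_def sum_list_sum_nth atLeast0LessThan)

lemma composition_length_le: "composition \<alpha> \<Longrightarrow> length \<alpha> \<le> sum_list \<alpha>"
  unfolding composition_def by (induction \<alpha>) fastforce+

lemma finite_M_support:
  assumes "F \<in> QSym" shows "finite {\<alpha>. composition \<alpha> \<and> M_coeff F \<alpha> \<noteq> 0}"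
proof -
  obtain d where d: "\<And>m. F m \<noteq> 0 \<Longrightarrow> size m \<le> d"
    using assms by (auto simp: QSym_def)
  have "{\<alpha>. composition \<alpha> \<and> M_coeff F \<alpha> \<noteq> 0} \<subseteq> {\<alpha>. set \<alpha> \<subseteq> {..d} \<and> length \<alpha> \<le> d}"
  proof safe
    fix \<alpha> assume \<alpha>: "composition \<alpha>" "M_coeff F \<alpha> \<noteq> 0"
    have le: "sum_list \<alpha> \<le> d" using d[of "packed \<alpha>"] \<alpha> by (simp add: M_coeff_def size_packed)
    show "length \<alpha> \<le> d" using composition_length_le[OF \<alpha>(1)] le by simp
    fix a assume "a \<in> set \<alpha>"
    then show "a \<le> d" using member_le_sum_list[of a \<alpha>] le by simp
  qed
  then show ?thesis by (rule finite_subset) (simp add: finite_lists_length_le)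
qed

lemma QSym_expansion:
  assumes "F \<in> QSym"
  shows "F m = (\<Sum>\<alpha> | composition \<alpha> \<and> M_coeff F \<alpha> \<noteq> 0. M_coeff F \<alpha> * M \<alpha> m)"
proof -
  let ?S = "{\<alpha>. composition \<alpha> \<and> M_coeff F \<alpha> \<noteq> 0}"
  have "(\<Sum>\<alpha>\<in>?S. M_coeff F \<alpha> * M \<alpha> m) =
      (\<Sum>\<alpha>\<in>?S. if \<alpha> = exponents m then (if 0 \<in># m then 0 else M_coeff F \<alpha>) else 0)"
    by (rule sum.cong) (auto simp: M_def)
  also have "\<dots> = (if 0 \<in># m then 0 else M_coeff F (exponents m))"
    using finite_M_support[OF assms] by (auto simp: composition_exponents)
  also have "\<dots> = F m"
  proof (cases "0 \<in># m")
    case True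
    then show ?thesis using assms by (simp add: QSym_def)
  next
    case False
    have "F (packed (exponents m)) = F m"
      using assms False zero_not_in_packed exponents_packed[OF composition_exponents]
      unfolding QSym_def mem_Collect_eq by metis
    then show ?thesis using False by (simp add: M_coeff_def)
  qed
  finally show ?thesis by simp
qed

lemma M_coeff_M:
  "composition \<beta> \<Longrightarrow> M_coeff (M \<alpha>) \<beta> = (if \<beta> = \<alpha> then 1 else 0)"
  by (simp add: M_coeff_def M_def zero_not_in_packed exponents_packed)

lemma antipode_of_M:
  assumes "composition \<alpha>" shows "antipode (M \<alpha>) = antipode_M \<alpha>"
proof -
  have "{\<beta>. composition \<beta> \<and> M_coeff (M \<alpha> :: 'a series) \<beta> \<noteq> 0} = {\<alpha>}"
    using assms by (auto simp: M_coeff_M split: if_splits)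
  then show ?thesis using assms by (simp add: antipode_def M_coeff_M)
qed

lemma antipode_linear:
  assumes "F \<in> QSym" "H \<in> QSym"
  shows "antipode (\<lambda>m. a * F m + b * H m) = (\<lambda>m. a * antipode F m + b * antipode H m)"
proof
  fix m
  let ?K = "\<lambda>m. a * F m + b * H m"
  let ?T = "{\<alpha>. composition \<alpha> \<and> M_coeff F \<alpha> \<noteq> 0} \<union> {\<alpha>. composition \<alpha> \<and> M_coeff H \<alpha> \<noteq> 0}"
  have fin: "finite ?T" using assms finite_M_support by blast
  have *: "antipode X m = (\<Sum>\<alpha>\<in>?T. M_coeff X \<alpha> * antipode_M \<alpha> m)"
    if "{\<alpha>. composition \<alpha> \<and> M_coeff X \<alpha> \<noteq> 0} \<subseteq> ?T" for X
    unfolding antipode_def by (rule sum.mono_neutral_left[OF fin that]) auto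
  have "antipode ?K m = (\<Sum>\<alpha>\<in>?T. M_coeff ?K \<alpha> * antipode_M \<alpha> m)"
    by (rule *) (auto simp: M_coeff_def)
  moreover have "antipode F m = (\<Sum>\<alpha>\<in>?T. M_coeff F \<alpha> * antipode_M \<alpha> m)" by (rule *) auto
  moreover have "antipode H m = (\<Sum>\<alpha>\<in>?T. M_coeff H \<alpha> * antipode_M \<alpha> m)" by (rule *) auto
  ultimately show "antipode ?K m = a * antipode F m + b * antipode H m"
    by (simp add: M_coeff_def algebra_simps sum.distrib sum_distrib_left)
qed

lemma fixed_D_partitions_relabel:
  assumes D: "double_poset D" and g: "g \<in> Aut D"
    and f: "f \<in> fixed_D_partitions D g" "f ` points D \<subseteq> A"
    and h: "strict_mono_on A h" "h ` A \<subseteq> {1..}"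
  shows "restrict (h \<circ> f) (points D) \<in> fixed_D_partitions D g"
proof -
  have sub: "ord1 D \<subseteq> points D \<times> points D"
    using D by (auto simp: double_poset_def partial_order_on_def preorder_on_def)
  have gp: "g permutes points D" using g by (simp add: Aut_def)
  have fg: "f (g x) = f x" for x using f(1) by (auto simp: fixed_D_partitions_def fun_eq_iff)
  have mono: "h (f x) \<le> h (f y)" if "f x \<le> f y" "x \<in> points D" "y \<in> points D" for x y
    using monotone_onD[OF strict_mono_on_imp_mono_on[OF h(1)], of "f x" "f y"] f(2) that
    by blast
  have smono: "h (f x) < h (f y)" if "f x < f y" "x \<in> points D" "y \<in> points D" for x y
    using strict_mono_onD[OF h(1), of "f x" "f y"] f(2) that by blast
  have "restrict (h \<circ> f) (points D) \<circ> g = restrict (h \<circ> f) (points D)"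
    using fg permutes_in_image[OF gp] by (auto simp: fun_eq_iff)
  moreover have "restrict (h \<circ> f) (points D) \<in> points D \<rightarrow>\<^sub>E {1..}"
    using f(2) h(2) by fastforce
  ultimately show ?thesis
    using f(1) sub mono smono
    by (auto simp: fixed_D_partitions_def D_partitions_def less1_def subset_iff)
qed

lemma card_fixed_D_partitions_relabel:
  assumes D: "double_poset D" and g: "g \<in> Aut D"
    and A: "A \<subseteq> {1..}" and h: "strict_mono_on A h" "h ` A \<subseteq> {1..}"
    and PQ: "\<And>f. f ` points D \<subseteq> A \<Longrightarrow> Q (restrict (h \<circ> f) (points D)) \<longleftrightarrow> P f"
  shows "card {f \<in> fixed_D_partitions D g. f ` points D \<subseteq> A \<and> P f} =
         card {f \<in> fixed_D_partitions D g. f ` points D \<subseteq> h ` A \<and> Q f}"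
proof -
  define k where "k = inv_into A h"
  let ?N = "points D"
  have inj: "inj_on h A" using h(1) by (rule strict_mono_on_imp_inj_on)
  have kh: "k (h x) = x" if "x \<in> A" for x using inj that by (simp add: k_def)
  have hk: "h (k y) = y" if "y \<in> h ` A" for y using that by (auto simp: kh)
  have k: "strict_mono_on (h ` A) k"
    using h(1) by (auto simp: strict_mono_on_def kh) (metis h(1) strict_mono_on_less)
  have kim: "k ` h ` A = A" by (force simp: kh image_iff)
  have ext: "f \<in> extensional ?N" if "f \<in> fixed_D_partitions D g" for f
    using that by (auto simp: fixed_D_partitions_def D_partitions_def PiE_def)
  have hkf: "restrict (h \<circ> restrict (k \<circ> f) ?N) ?N = f"
    if "f \<in> fixed_D_partitions D g" "f ` ?N \<subseteq> h ` A" for f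
    using that hk ext[OF that(1)] by (auto simp: fun_eq_iff extensional_def image_subset_iff)
  have khf: "restrict (k \<circ> restrict (h \<circ> f) ?N) ?N = f"
    if "f \<in> fixed_D_partitions D g" "f ` ?N \<subseteq> A" for f
    using that kh ext[OF that(1)] by (auto simp: fun_eq_iff extensional_def image_subset_iff)
  have kA: "restrict (k \<circ> f) ?N ` ?N \<subseteq> A" if "f ` ?N \<subseteq> h ` A" for f
    using that kh by fastforce
  have "bij_betw (\<lambda>f. restrict (h \<circ> f) ?N)
      {f \<in> fixed_D_partitions D g. f ` ?N \<subseteq> A \<and> P f}
      {f \<in> fixed_D_partitions D g. f ` ?N \<subseteq> h ` A \<and> Q f}"
  proof (rule bij_betw_byWitness[where f' = "\<lambda>f. restrict (k \<circ> f) ?N"])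
    show "\<forall>f\<in>{f \<in> fixed_D_partitions D g. f ` ?N \<subseteq> A \<and> P f}.
        restrict (k \<circ> restrict (h \<circ> f) ?N) ?N = f"
      using khf by blast
    show "\<forall>f\<in>{f \<in> fixed_D_partitions D g. f ` ?N \<subseteq> h ` A \<and> Q f}.
        restrict (h \<circ> restrict (k \<circ> f) ?N) ?N = f"
      using hkf by blast
    show "(\<lambda>f. restrict (h \<circ> f) ?N) ` {f \<in> fixed_D_partitions D g. f ` ?N \<subseteq> A \<and> P f}
        \<subseteq> {f \<in> fixed_D_partitions D g. f ` ?N \<subseteq> h ` A \<and> Q f}"
    proof (rule image_subsetI, rule CollectI, intro conjI)
      fix f assume f: "f \<in> {f \<in> fixed_D_partitions D g. f ` ?N \<subseteq> A \<and> P f}"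
      show "restrict (h \<circ> f) ?N \<in> fixed_D_partitions D g"
        using f by (intro fixed_D_partitions_relabel[OF D g _ _ h]) auto
      show "restrict (h \<circ> f) ?N ` ?N \<subseteq> h ` A" using f by auto
      show "Q (restrict (h \<circ> f) ?N)" using f PQ by blast
    qed
    show "(\<lambda>f. restrict (k \<circ> f) ?N) ` {f \<in> fixed_D_partitions D g. f ` ?N \<subseteq> h ` A \<and> Q f}
        \<subseteq> {f \<in> fixed_D_partitions D g. f ` ?N \<subseteq> A \<and> P f}"
    proof (rule image_subsetI, rule CollectI, intro conjI)
      fix f assume f: "f \<in> {f \<in> fixed_D_partitions D g. f ` ?N \<subseteq> h ` A \<and> Q f}"
      show "restrict (k \<circ> f) ?N \<in> fixed_D_partitions D g"
        using f A kim by (intro fixed_D_partitions_relabel[OF D g _ _ k]) auto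
      show im: "restrict (k \<circ> f) ?N ` ?N \<subseteq> A" using f kA by blast
      show "P (restrict (k \<circ> f) ?N)" using PQ[OF im] f hkf[of f] by auto
    qed
  qed
  then show ?thesis by (rule bij_betw_same_card)
qed

lemma ex_strict_mono_image:
  fixes A B :: "nat set"
  assumes "finite A" "finite B" "card A = card B"
  obtains h where "strict_mono_on A h" "h ` A = B"
proof -
  obtain a where a: "bij_betw a {..<card A} A" "strict_mono_on {..<card A} a"
    using ex_bij_betw_strict_mono_card[OF assms(1)] .
  obtain b where b: "bij_betw b {..<card B} B" "strict_mono_on {..<card B} b"
    using ex_bij_betw_strict_mono_card[OF assms(2)] .
  define h where "h = b \<circ> inv_into {..<card A} a"
  have ha: "h (a i) = b i" if "i < card A" for i
    using that a(1) by (simp add: h_def bij_betw_inv_into_left)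
  have A: "A = a ` {..<card A}" using a(1) by (simp add: bij_betw_def)
  have B: "B = b ` {..<card A}" using b(1) assms(3) by (simp add: bij_betw_def)
  have "strict_mono_on A h"
  proof (rule strict_mono_onI)
    fix x y assume "x \<in> A" "y \<in> A" "x < y"
    then obtain i j where ij: "i < card A" "j < card A" "x = a i" "y = a j"
      using A by (metis imageE lessThan_iff)
    then have "i < j" using a(2) \<open>x < y\<close> by (metis lessThan_iff strict_mono_on_less)
    then show "h x < h y" using ij b(2) assms(3) by (simp add: ha strict_mono_onD)
  qed
  moreover have "h ` A = B"
    by (subst A, subst B) (auto simp: ha image_iff)
  ultimately show ?thesis using that by blast
qed

lemma exponents_inject:
  assumes "set_mset m = set_mset m'" "exponents m = exponents m'"
  shows "m = m'"
proof (rule multiset_eqI)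
  fix x
  show "count m x = count m' x"
  proof (cases "x \<in># m")
    case True
    then show ?thesis using assms by (auto simp: exponents_def)
  next
    case False
    then show ?thesis using assms(1) by (metis not_in_iff)
  qed
qed

lemma length_exponents: "length (exponents m) = card (set_mset m)"
  by (simp add: exponents_def)

lemma Omega_in_QSym:
  assumes D: "double_poset D" "finite (points D)" and g: "g \<in> Aut D"
  shows "Omega D g \<in> QSym"
proof -
  have set_monomial: "set_mset (monomial_of D f) = f ` points D" for f
    using D(2) by (simp add: monomial_of_def)
  have Om: "Omega D g m = of_nat (card {f \<in> fixed_D_partitions D g.
      f ` points D \<subseteq> set_mset m \<and> monomial_of D f = m})" for m
    unfolding Omega_def by (rule arg_cong[where f = "\<lambda>X. of_nat (card X)"])
      (use set_monomial in auto)
  have pos: "0 \<notin># monomial_of D f" if "f \<in> fixed_D_partitions D g" for f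
  proof -
    have "f \<in> points D \<rightarrow> {1..}"
      using that by (auto simp: fixed_D_partitions_def D_partitions_def)
    then show ?thesis unfolding set_monomial by force
  qed
  have nz: "\<exists>f \<in> fixed_D_partitions D g. monomial_of D f = m" if "Omega D g m \<noteq> 0" for m
  proof (rule ccontr)
    assume "\<not> ?thesis"
    then have "{f \<in> fixed_D_partitions D g. monomial_of D f = m} = {}" by blast
    with that show False by (simp add: Omega_def)
  qed
  have size: "\<exists>d. \<forall>m. Omega D g m \<noteq> 0 \<longrightarrow> size m \<le> d"
    using nz by (intro exI[of _ "card (points D)"]) (fastforce simp: monomial_of_def)
  have zero: "Omega D g m = 0" if "0 \<in># m" for m
    using nz pos that by blast
  have "Omega D g m = Omega D g m'"
    if m: "0 \<notin># m" "0 \<notin># m'" "exponents m = exponents m'" for m m'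
  proof -
    have "card (set_mset m) = card (set_mset m')"
      using m(3) by (metis length_exponents)
    then obtain h where h: "strict_mono_on (set_mset m) h" "h ` set_mset m = set_mset m'"
      by (rule ex_strict_mono_image[rotated 2]) auto
    have hm: "image_mset h m = m'"
      using h m(3) by (intro exponents_inject) (auto simp: exponents_image_mset)
    have inj: "inj_on h (set_mset m)" using h(1) by (rule strict_mono_on_imp_inj_on)
    have mon: "monomial_of D (restrict (h \<circ> f) (points D)) = image_mset h (monomial_of D f)" for f
      using D(2) by (auto simp: monomial_of_def multiset.map_comp intro!: image_mset_cong)
    have "card {f \<in> fixed_D_partitions D g. f ` points D \<subseteq> set_mset m \<and> monomial_of D f = m} =
        card {f \<in> fixed_D_partitions D g. f ` points D \<subseteq> h ` set_mset m \<and> monomial_of D f = m'}"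
    proof (rule card_fixed_D_partitions_relabel[OF D(1) g _ h(1)])
      show "set_mset m \<subseteq> {1..}" using m(1) by (auto simp: Suc_le_eq intro!: Nat.gr0I)
      show "h ` set_mset m \<subseteq> {1..}" unfolding h(2)
        using m(2) by (auto simp: Suc_le_eq intro!: Nat.gr0I)
      fix f assume f: "f ` points D \<subseteq> set_mset m"
      show "monomial_of D (restrict (h \<circ> f) (points D)) = m' \<longleftrightarrow> monomial_of D f = m"
      proof
        assume "monomial_of D (restrict (h \<circ> f) (points D)) = m'"
        then have eq: "image_mset h (monomial_of D f) = image_mset h m" using mon hm by simp
        have sub: "set_mset (monomial_of D f) \<subseteq> set_mset m" using f set_monomial by simp
        have "h ` set_mset (monomial_of D f) = h ` set_mset m" using eq by (metis set_image_mset)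
        then have "set_mset (monomial_of D f) = set_mset m"
          using inj sub by (simp add: inj_on_image_eq_iff)
        moreover have "exponents (monomial_of D f) = exponents m"
          using eq exponents_image_mset[OF h(1)] sub by (metis order_refl)
        ultimately show "monomial_of D f = m" by (rule exponents_inject)
      qed (use mon hm in simp)
    qed
    then show ?thesis unfolding Om h(2) by simp
  qed
  with size zero show ?thesis unfolding QSym_def by blast
qed

lemma Omega_poly_unique:
  fixes p q :: "'k::field_char_0 poly"
  assumes "\<And>n. n \<ge> 1 \<Longrightarrow> poly p (of_nat n) = poly q (of_nat n)"
  shows "p = q"
proof (rule ccontr)
  assume "p \<noteq> q"
  then have "finite {x. poly (p - q) x = 0}" by (intro poly_roots_finite) simp
  moreover have "of_nat ` {1..} \<subseteq> {x. poly (p - q) x = 0}" using assms by auto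
  ultimately have "finite ((of_nat :: nat \<Rightarrow> 'k) ` {1..})" by (rule finite_subset[rotated])
  then show False
    by (auto dest!: finite_imageD intro: inj_on_subset[OF inj_of_nat] simp: infinite_Ici)
qed

lemma Omega_poly_exists:
  assumes D: "double_poset D" "finite (points D)" and g: "g \<in> Aut D"
  shows "\<exists>p :: 'k::field_char_0 poly. \<forall>n\<ge>1. poly p (of_nat n) =
     of_nat (card {f \<in> fixed_D_partitions D g. f ` points D \<subseteq> {1..n}})"
proof -
  let ?N = "points D" and ?FP = "fixed_D_partitions D g"
  define s where "s k = card {f \<in> ?FP. f ` ?N = {1..k}}" for k :: nat
  define b :: "nat \<Rightarrow> 'k poly" where
    "b k = smult (inverse (fact k)) (\<Prod>i=0..<k. [:- of_nat i, 1:])" for k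
  have b: "poly (b k) (of_nat n) = of_nat (n choose k)" for k n
    by (simp add: b_def poly_prod binomial_gbinomial gbinomial_prod_rev field_simps)
  have s: "card {f \<in> ?FP. f ` ?N = A} = s (card A)" if A: "finite A" "A \<subseteq> {1..}" for A
  proof -
    obtain h where h: "strict_mono_on A h" "h ` A = {1..card A}"
      using ex_strict_mono_image[OF A(1), of "{1..card A}"] by auto
    have inj: "inj_on h A" using h(1) by (rule strict_mono_on_imp_inj_on)
    have "card {f \<in> ?FP. f ` ?N \<subseteq> A \<and> f ` ?N = A} =
        card {f \<in> ?FP. f ` ?N \<subseteq> h ` A \<and> f ` ?N = h ` A}"
    proof (rule card_fixed_D_partitions_relabel[OF D(1) g A(2) h(1)])
      fix f assume f: "f ` ?N \<subseteq> A"
      have "restrict (h \<circ> f) ?N ` ?N = h ` f ` ?N" by auto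
      then show "restrict (h \<circ> f) ?N ` ?N = h ` A \<longleftrightarrow> f ` ?N = A"
        using f inj by (simp add: inj_on_image_eq_iff)
    qed (use h in auto)
    moreover have "{f \<in> ?FP. f ` ?N \<subseteq> X \<and> f ` ?N = X} = {f \<in> ?FP. f ` ?N = X}" for X by auto
    ultimately show ?thesis by (simp add: s_def h(2))
  qed
  have count: "card {f \<in> ?FP. f ` ?N \<subseteq> {1..n}} = (\<Sum>k\<le>card ?N. s k * (n choose k))" for n
  proof -
    have ext: "{f \<in> ?FP. f ` ?N \<subseteq> {1..n}} \<subseteq> ?N \<rightarrow>\<^sub>E {1..n}"
      by (auto simp: fixed_D_partitions_def D_partitions_def)
    have fin: "finite {f \<in> ?FP. f ` ?N \<subseteq> {1..n}}"
      using ext by (rule finite_subset) (simp add: D(2) finite_PiE)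
    have fin': "finite {f \<in> ?FP. f ` ?N = A}" if "A \<subseteq> {1..n}" for A
      using fin by (rule finite_subset[rotated]) (use that in auto)
    have "{f \<in> ?FP. f ` ?N \<subseteq> {1..n}} = (\<Union>A\<in>Pow {1..n}. {f \<in> ?FP. f ` ?N = A})" by auto
    then have "card {f \<in> ?FP. f ` ?N \<subseteq> {1..n}} =
        (\<Sum>A\<in>Pow {1..n}. card {f \<in> ?FP. f ` ?N = A})"
      by (simp only:) (rule card_UN_disjoint, use fin' in auto)
    also have "\<dots> = (\<Sum>A\<in>Pow {1..n}. s (card A))"
      by (rule sum.cong) (auto intro!: s finite_subset[of _ "{1..n}"])
    also have "\<dots> = (\<Sum>k\<le>n. \<Sum>A | A \<in> Pow {1..n} \<and> card A = k. s (card A))"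
      by (rule sum.group[symmetric]) (auto dest: card_mono[rotated])
    also have "\<dots> = (\<Sum>k\<le>n. s k * (n choose k))"
      by (rule sum.cong) (auto simp: n_subsets)
    also have "\<dots> = (\<Sum>k\<le>max n (card ?N). s k * (n choose k))"
      by (rule sum.mono_neutral_left) auto
    also have "\<dots> = (\<Sum>k\<le>card ?N. s k * (n choose k))"
    proof (rule sum.mono_neutral_right)
      have "s k = 0" if "k > card ?N" for k
      proof -
        have "f ` ?N \<noteq> {1..k}" for f using card_image_le[OF D(2), of f] that by auto
        then show ?thesis by (simp add: s_def)
      qed
      then show "\<forall>k\<in>{..max n (card ?N)} - {..card ?N}. s k * (n choose k) = 0" by auto
    qed auto
    finally show ?thesis .
  qed
  have "\<forall>n\<ge>1. poly (\<Sum>k\<le>card ?N. smult (of_nat (s k)) (b k)) (of_nat n) =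
      of_nat (card {f \<in> ?FP. f ` ?N \<subseteq> {1..n}})"
    by (simp only: count poly_sum poly_smult b of_nat_sum of_nat_mult) blast
  then show ?thesis by blast
qed

lemma Omega_poly_eval:
  assumes "double_poset D" "finite (points D)" "g \<in> Aut D" "n \<ge> 1"
  shows "poly (Omega_poly D g) (of_nat n :: 'k::field_char_0) =
     of_nat (card {f \<in> fixed_D_partitions D g. f ` points D \<subseteq> {1..n}})"
proof -
  let ?P = "\<lambda>p :: 'k poly. \<forall>n\<ge>1. poly p (of_nat n) =
     of_nat (card {f \<in> fixed_D_partitions D g. f ` points D \<subseteq> {1..n}})"
  have "\<exists>!p. ?P p"
    using Omega_poly_exists[OF assms(1-3)] by (auto intro: Omega_poly_unique)
  then have "?P (Omega_poly D g)" unfolding Omega_poly_def by (rule theI')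
  then show ?thesis using assms(4) by blast
qed

end

theory Submission
  imports Defs "HOL-Combinatorics.Cycles"
begin

text \<open>
  A \<open>g\<close>-invariant \<open>D\<close>-partition is a chain of \<open>g\<close>-invariant down-sets of \<open>\<le>\<^sub>1\<close> whose successive
  differences are weak, i.e. carry no pair \<open>x <\<^sub>1 y\<close>, \<open>y <\<^sub>2 x\<close>; read from the top, a partition of the dual
  is such a chain with strict differences, i.e. without pairs \<open>x <\<^sub>1 y\<close>, \<open>x <\<^sub>2 y\<close>. Let \<open>A\<close> and \<open>B\<close> be the
  matrices indexed by invariant down-sets with \<open>A(I, K) = [K - I is weak]\<close> and
  \<open>B(I, K) = (-1)\<^bsup>|K - I|\<^esup> sgn(g restricted to K - I) [K - I is strict]\<close>. Toggling the orbit of a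
  \<open>\<le>\<^sub>2\<close>-maximal element of \<open>J - I\<close> shows \<open>\<Sum>\<^sub>K A(I, K) B(K, J) = [I = J]\<close>, so \<open>B\<close> is the inverse of \<open>A\<close>.
  As \<open>A\<close> is unipotent, \<open>A\<^sup>n\<close> extends polynomially to negative \<open>n\<close>, which gives the reciprocity of the
  polynomials. Grading \<open>A\<close> and \<open>B\<close> by \<open>|K - I|\<close> expresses each graded piece of \<open>B\<close> as the
  alternating sum over compositions of products of pieces of \<open>A\<close>, which is the antipode.
\<close>

section \<open>Signs of cycles and restricted permutations\<close>

text \<open>Each unfolding of \<open>cycle_of_list\<close> splits off one transposition of distinct
  elements, and a one-element list gives the identity.\<close>

lemma sign_cycle_of_list:
  "distinct cs \<Longrightarrow> cs \<noteq> [] \<Longrightarrow> sign (cycle_of_list cs) = (-1) ^ (length cs - 1)"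
proof (induction cs rule: cycle_of_list.induct)
  case (1 i j cs)
  then show ?case
    by (simp add: sign_compose permutation_swap_id permutation_of_cycle sign_swap_id del: o_apply)
qed auto

text \<open>\<open>support p x\<close> lists the cycle of \<open>p\<close> through \<open>x\<close>,
  and on its elements \<open>p\<close> acts as that single cycle, so the sign of a cycle
  applies.\<close>

lemma sign_on_support:
  assumes "permutation p"
  shows "sign_on (set (support p x)) p = (-1) ^ (card (set (support p x)) - 1)"
proof -
  have dist: "distinct (support p x)" by (rule cycle_of_permutation[OF assms])
  have "support p x \<noteq> []" using least_power_of_permutation(2)[OF assms, of x] by simp
  moreover have "restrict_id p (set (support p x)) = cycle_of_list (support p x)"
  proof
    fix y show "restrict_id p (set (support p x)) y = cycle_of_list (support p x) y"
      using cycle_restrict[OF assms, of y x] id_outside_supp[of y "support p x"]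
      by (cases "y \<in> set (support p x)") (simp_all add: restrict_id_def del: set_map)
  qed
  ultimately show ?thesis
    using sign_cycle_of_list[OF dist] distinct_card[OF dist] unfolding sign_on_def by metis
qed

lemma sign_on_Un:
  assumes "finite A" "finite B" "A \<inter> B = {}" "bij_betw p A A" "bij_betw p B B"
  shows "sign_on (A \<union> B) p = sign_on A p * sign_on B p"
proof -
  have "restrict_id p (A \<union> B) = restrict_id p A \<circ> restrict_id p B"
    using assms(3) bij_betwE[OF assms(4)] bij_betwE[OF assms(5)]
    by (auto simp: restrict_id_def fun_eq_iff)
  moreover have "permutation (restrict_id p A)" "permutation (restrict_id p B)"
    using assms by (auto intro: permutes_imp_permutation permutes_restrict_id)
  ultimately show ?thesis by (simp add: sign_on_def sign_compose)
qed

section \<open>Refinements of compositions\<close>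

definition refinements :: "nat list \<Rightarrow> nat list set" where
  "refinements \<beta> = {\<alpha>. composition \<alpha> \<and> refines \<alpha> \<beta>}"

lemma refinesE:
  assumes "refines \<alpha> \<beta>"
  obtains bs where "[] \<notin> set bs" "concat bs = \<alpha>" "map sum_list bs = \<beta>"
  using assms unfolding refines_def by (elim exE conjE) (rule that)

lemma refines_sum_list: "refines \<alpha> \<beta> \<Longrightarrow> sum_list \<alpha> = sum_list \<beta>"
proof -
  have "sum_list (concat bs) = sum_list (map sum_list bs)" for bs :: "nat list list"
    by (induction bs) auto
  then show "refines \<alpha> \<beta> \<Longrightarrow> sum_list \<alpha> = sum_list \<beta>" by (auto simp: refines_def)
qed

lemma refines_composition: "composition \<alpha> \<Longrightarrow> refines \<alpha> \<beta> \<Longrightarrow> composition \<beta>"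
proof -
  assume "composition \<alpha>" "refines \<alpha> \<beta>"
  then obtain bs where bs: "[] \<notin> set bs" "concat bs = \<alpha>" "map sum_list bs = \<beta>"
    by (auto simp: refines_def)
  have "0 < sum_list c" if c: "c \<in> set bs" for c
  proof -
    have "c \<noteq> []" using c bs(1) by metis
    then obtain a where "a \<in> set c" by fastforce
    moreover from this have "0 < a" using c bs(2) \<open>composition \<alpha>\<close> by (auto simp: composition_def)
    ultimately show ?thesis using member_le_sum_list[of a c] by simp
  qed
  then show ?thesis using bs(3) by (auto simp: composition_def)
qed

lemma finite_compositions_sum: "finite {\<alpha>. composition \<alpha> \<and> sum_list \<alpha> = s}"
proof (rule finite_subset)
  show "{\<alpha>. composition \<alpha> \<and> sum_list \<alpha> = s} \<subseteq> {\<alpha>. set \<alpha> \<subseteq> {..s} \<and> length \<alpha> \<le> s}"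
    using composition_length_le member_le_sum_list by fastforce
qed (simp add: finite_lists_length_le)

lemma finite_refinements: "finite (refinements \<beta>)"
  by (rule finite_subset[OF _ finite_compositions_sum[of "sum_list \<beta>"]])
    (auto simp: refinements_def refines_sum_list)

lemma refinements_Nil: "refinements [] = {[]}"
  by (auto simp: refinements_def refines_def composition_def)

lemma refines_Cons_Cons:
  "refines \<alpha> \<beta> \<Longrightarrow> refines (b # \<alpha>) (b # \<beta>)"
  "refines \<alpha> (c # \<beta>) \<Longrightarrow> refines (b # \<alpha>) ((b + c) # \<beta>)"
proof -
  assume "refines \<alpha> \<beta>"
  then obtain bs where "[] \<notin> set bs" "concat bs = \<alpha>" "map sum_list bs = \<beta>"
    by (rule refinesE)
  then show "refines (b # \<alpha>) (b # \<beta>)" unfolding refines_def by (intro exI[of _ "[b] # bs"]) simp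
next
  assume "refines \<alpha> (c # \<beta>)"
  then obtain bs where bs: "[] \<notin> set bs" "concat bs = \<alpha>" "map sum_list bs = c # \<beta>"
    by (rule refinesE)
  then obtain x xs where "bs = x # xs" by (cases bs) auto
  then show "refines (b # \<alpha>) ((b + c) # \<beta>)"
    using bs unfolding refines_def by (intro exI[of _ "(b # x) # xs"]) simp
qed

text \<open>Split off the first part \<open>a\<close> of the refinement. If \<open>a = b\<close>,
  the first block is exhausted and the rest refines \<open>\<beta>\<close>; otherwise the remainder
  of the block still has to sum to \<open>b - a\<close>. This recursion has the same shape as
  \<open>signed_layers_rec\<close>.\<close>

lemma refinements_Cons:
  assumes b: "b > 0"
  shows "refinements (b # \<beta>) =
    (\<lambda>(a, \<alpha>). a # \<alpha>) ` (SIGMA a:{1..b}. refinements (if a = b then \<beta> else (b - a) # \<beta>))"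
    (is "?L = ?R")
proof (intro equalityI subsetI)
  fix \<alpha> assume "\<alpha> \<in> ?L"
  then have comp: "composition \<alpha>" and "refines \<alpha> (b # \<beta>)" by (auto simp: refinements_def)
  from this(2) obtain bs where bs: "[] \<notin> set bs" "concat bs = \<alpha>" "map sum_list bs = b # \<beta>"
    by (rule refinesE)
  then obtain a c cs where bs_eq: "bs = (a # c) # cs"
    by (metis list.exhaust list.set_intros(1) list.simps(8) list.distinct(1))
  define \<alpha>' where "\<alpha>' = c @ concat cs"
  have \<alpha>: "\<alpha> = a # \<alpha>'" using bs bs_eq by (simp add: \<alpha>'_def)
  have ab: "a + sum_list c = b" "map sum_list cs = \<beta>" using bs bs_eq by auto
  have a: "0 < a" and comp': "composition \<alpha>'" using comp \<alpha> by (auto simp: composition_def)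
  \<comment> \<open>Since all parts are positive, the remainder \<open>c\<close> of the first block
    is empty exactly when \<open>a = b\<close>.\<close>
  have "composition c" using comp' by (auto simp: composition_def \<alpha>'_def)
  then have c: "sum_list c = 0 \<longleftrightarrow> c = []"
    using composition_length_le[of c] by (metis le_zero_eq length_0_conv sum_list.Nil)
  have "refines \<alpha>' (if a = b then \<beta> else (b - a) # \<beta>)"
  proof (cases "a = b")
    case True
    then have "\<alpha>' = concat cs" using ab c by (simp add: \<alpha>'_def)
    then show ?thesis using True ab bs(1) bs_eq by (auto simp: refines_def)
  next
    case False
    then have "c \<noteq> []" using ab by auto
    then have "[] \<notin> set (c # cs)" "concat (c # cs) = \<alpha>'" "map sum_list (c # cs) = (b - a) # \<beta>"
      using bs(1) bs_eq ab by (auto simp: \<alpha>'_def)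
    then show ?thesis using False unfolding refines_def by (intro exI[of _ "c # cs"]) simp
  qed
  then show "\<alpha> \<in> ?R" using a ab comp' by (force simp: refinements_def \<alpha>)
next
  fix \<alpha> assume "\<alpha> \<in> ?R"
  then obtain a \<alpha>' where \<alpha>: "\<alpha> = a # \<alpha>'" "1 \<le> a" "a \<le> b"
    "composition \<alpha>'" "refines \<alpha>' (if a = b then \<beta> else (b - a) # \<beta>)"
    by (auto simp: refinements_def)
  then show "\<alpha> \<in> ?L"
    using refines_Cons_Cons(1)[of \<alpha>' \<beta> a] refines_Cons_Cons(2)[of \<alpha>' "b - a" \<beta> a]
    by (auto simp: refinements_def composition_def split: if_splits)
qed

text \<open>\<open>M (rev \<beta>)\<close> has a nonzero coefficient at \<open>m\<close> only for
  \<open>\<beta> = rev (exponents m)\<close>. The inner sum of \<open>antipode_M \<alpha>\<close>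
  therefore collapses to the indicator that \<open>\<alpha>\<close> refines this
  composition.\<close>

lemma antipode_coeff:
  fixes F :: "'k::field_char_0 series"
  assumes F: "F \<in> QSym" and m: "0 \<notin># m"
  shows "antipode F m = (\<Sum>\<alpha>\<in>refinements (rev (exponents m)). (-1) ^ length \<alpha> * M_coeff F \<alpha>)"
proof -
  let ?S = "{\<alpha>. composition \<alpha> \<and> M_coeff F \<alpha> \<noteq> 0}"
  have inner: "antipode_M \<alpha> m = (-1) ^ length \<alpha> * (of_bool (\<alpha> \<in> refinements (rev (exponents m))) :: 'k)"
    if \<alpha>: "composition \<alpha>" for \<alpha>
  proof -
    have fin: "finite {\<beta>. composition \<beta> \<and> refines \<alpha> \<beta>}"
      by (rule finite_subset[OF _ finite_compositions_sum[of "sum_list \<alpha>"]])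
        (auto simp: refines_sum_list)
    have "(\<Sum>\<beta> | composition \<beta> \<and> refines \<alpha> \<beta>. M (rev \<beta>) m) =
        (\<Sum>\<beta> | composition \<beta> \<and> refines \<alpha> \<beta>. if \<beta> = rev (exponents m) then 1 else 0 :: 'k)"
      by (rule sum.cong) (use m in \<open>auto simp: M_def\<close>)
    also have "\<dots> = of_bool (\<alpha> \<in> refinements (rev (exponents m)))"
      using fin \<alpha> refines_composition[OF \<alpha>] by (auto simp: refinements_def)
    finally show ?thesis by (simp only: antipode_M_def)
  qed
  have "antipode F m = (\<Sum>\<alpha>\<in>?S. if \<alpha> \<in> refinements (rev (exponents m))
      then (-1) ^ length \<alpha> * M_coeff F \<alpha> else 0)"
    unfolding antipode_def by (rule sum.cong) (auto simp: inner)
  also have "\<dots> = (\<Sum>\<alpha>\<in>?S \<inter> refinements (rev (exponents m)). (-1) ^ length \<alpha> * M_coeff F \<alpha>)"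
    using finite_M_support[OF F] by (simp add: sum.inter_restrict)
  also have "\<dots> = (\<Sum>\<alpha>\<in>refinements (rev (exponents m)). (-1) ^ length \<alpha> * M_coeff F \<alpha>)"
    by (rule sum.mono_neutral_left[OF finite_refinements]) (auto simp: refinements_def)
  finally show ?thesis .
qed

section \<open>Functions with prescribed level sets\<close>

text \<open>The value \<open>0\<close> marks the points of the initial set \<open>I\<close>; the proper values start at \<open>1\<close>.\<close>

definition layered :: "'a set \<Rightarrow> ('a set \<Rightarrow> 'a set \<Rightarrow> bool) list \<Rightarrow> 'a set \<Rightarrow> ('a \<Rightarrow> nat) set" where
  "layered N Rs I = {f \<in> N \<rightarrow>\<^sub>E {..length Rs}. {x\<in>N. f x = 0} = I \<and>
     (\<forall>j<length Rs. (Rs ! j) {x\<in>N. f x \<le> j} {x\<in>N. f x \<le> Suc j})}"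

lemma finite_layered: "finite N \<Longrightarrow> finite (layered N Rs I)"
  by (rule finite_subset[of _ "N \<rightarrow>\<^sub>E {..length Rs}"]) (auto simp: layered_def finite_PiE)

lemma card_layered_Nil: "I \<subseteq> N \<Longrightarrow> card (layered N [] I) = of_bool (I = N)"
proof -
  have "layered N [] I = (if I = N then {\<lambda>x\<in>N. 0} else {})" if "I \<subseteq> N"
    using that by (auto simp: layered_def PiE_def extensional_def fun_eq_iff)
  then show "I \<subseteq> N \<Longrightarrow> card (layered N [] I) = of_bool (I = N)" by simp
qed

text \<open>Transfer-matrix recursion: sort the functions by their sublevel set
  \<open>K = {x\<in>N. f x \<le> 1}\<close> and lower all values by one, which makes
  \<open>K\<close> the initial set of a chain with one layer less.\<close>

lemma card_layered_Cons:
  assumes N: "finite N" and I: "I \<subseteq> N"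
  shows "card (layered N (R # Rs) I) = (\<Sum>K | K \<subseteq> N \<and> I \<subseteq> K \<and> R I K. card (layered N Rs K))"
proof -
  define F where "F K = {f \<in> layered N (R # Rs) I. {x\<in>N. f x \<le> 1} = K}" for K
  have bij: "bij_betw (\<lambda>f. \<lambda>x\<in>N. f x - 1) (F K) (layered N Rs K)"
    if K: "K \<subseteq> N" "I \<subseteq> K" "R I K" for K
  \<comment> \<open>Truncated subtraction sends both \<open>0\<close> and \<open>1\<close> to
    \<open>0\<close>; the known initial set \<open>I\<close> tells which points get their
    \<open>0\<close> back.\<close>
  proof (rule bij_betw_byWitness[where f' = "\<lambda>f. \<lambda>x\<in>N. if x \<in> I then 0 else Suc (f x)"])
    have "(\<lambda>x\<in>N. if x \<in> I then 0 else Suc ((\<lambda>x\<in>N. f x - 1) x)) x = f x" if "f \<in> F K" for f x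
      using that by (cases "x \<in> N") (auto simp: F_def layered_def PiE_def extensional_def)
    then show "\<forall>f\<in>F K. (\<lambda>x\<in>N. if x \<in> I then 0 else Suc ((\<lambda>x\<in>N. f x - 1) x)) = f" by blast
    have "(\<lambda>x\<in>N. (\<lambda>x\<in>N. if x \<in> I then 0 else Suc (f x)) x - 1) x = f x"
      if "f \<in> layered N Rs K" for f x
      using that K by (cases "x \<in> N") (auto simp: layered_def PiE_def extensional_def)
    then show "\<forall>f\<in>layered N Rs K. (\<lambda>x\<in>N. (\<lambda>x\<in>N. if x \<in> I then 0 else Suc (f x)) x - 1) = f" by blast
    show "(\<lambda>f. \<lambda>x\<in>N. f x - 1) ` F K \<subseteq> layered N Rs K"
    proof (rule image_subsetI)
      fix f assume f: "f \<in> F K"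
      let ?f = "\<lambda>x\<in>N. f x - 1"
      have le: "{x\<in>N. ?f x \<le> j} = {x\<in>N. f x \<le> Suc j}" for j by auto
      have "{x\<in>N. ?f x = 0} = K" using f by (auto simp: F_def)
      moreover have "(Rs ! j) {x\<in>N. ?f x \<le> j} {x\<in>N. ?f x \<le> Suc j}" if "j < length Rs" for j
      proof -
        have "((R # Rs) ! Suc j) {x\<in>N. f x \<le> Suc j} {x\<in>N. f x \<le> Suc (Suc j)}"
          using f that unfolding F_def layered_def by (auto simp del: nth_Cons_Suc)
        then show ?thesis by (simp only: le nth_Cons_Suc)
      qed
      moreover have "f x - 1 \<le> length Rs" if "x \<in> N" for x
      proof -
        have "f \<in> N \<rightarrow>\<^sub>E {..Suc (length Rs)}" using f by (simp add: F_def layered_def)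
        from PiE_mem[OF this that] show ?thesis by simp
      qed
      ultimately show "?f \<in> layered N Rs K" unfolding layered_def by fastforce
    qed
    show "(\<lambda>f. \<lambda>x\<in>N. if x \<in> I then 0 else Suc (f x)) ` layered N Rs K \<subseteq> F K"
    proof (rule image_subsetI)
      fix f assume f: "f \<in> layered N Rs K"
      let ?f = "\<lambda>x\<in>N. if x \<in> I then 0 else Suc (f x)"
      have zero: "f x = 0" if "x \<in> I" for x using f that K by (auto simp: layered_def)
      have 0: "{x\<in>N. ?f x \<le> 0} = I" "{x\<in>N. ?f x = 0} = I" using I by auto
      have le: "{x\<in>N. ?f x \<le> Suc j} = {x\<in>N. f x \<le> j}" for j using zero by auto
      have 1: "{x\<in>N. ?f x \<le> 1} = K" using le[of 0] f by (simp add: layered_def del: restrict_apply)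
      have "((R # Rs) ! j) {x\<in>N. ?f x \<le> j} {x\<in>N. ?f x \<le> Suc j}" if "j < Suc (length Rs)" for j
      proof (cases j)
        case 0
        then show ?thesis using \<open>R I K\<close> 1 \<open>{x\<in>N. ?f x \<le> 0} = I\<close> by (simp del: restrict_apply)
      next
        case (Suc i)
        then show ?thesis using f that unfolding Suc le by (simp add: layered_def)
      qed
      moreover have "?f \<in> N \<rightarrow>\<^sub>E {..Suc (length Rs)}" using f by (auto simp: layered_def)
      ultimately show "?f \<in> F K" using 0 1 by (simp add: F_def layered_def del: restrict_apply)
    qed
  qed
  let ?Ks = "{K. K \<subseteq> N \<and> I \<subseteq> K \<and> R I K}"
  have "layered N (R # Rs) I = (\<Union>K\<in>?Ks. F K)"
  proof (intro equalityI subsetI)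
    fix f assume f: "f \<in> layered N (R # Rs) I"
    have "I \<subseteq> {x\<in>N. f x \<le> 1}" "R I {x\<in>N. f x \<le> 1}"
      using f by (auto simp: layered_def)
    then show "f \<in> (\<Union>K\<in>?Ks. F K)" using f by (auto simp: F_def)
  qed (auto simp: F_def)
  also have "card \<dots> = (\<Sum>K\<in>?Ks. card (F K))"
    by (rule card_UN_disjoint) (use N finite_layered[OF N] in \<open>auto simp: F_def\<close>)
  also have "\<dots> = (\<Sum>K\<in>?Ks. card (layered N Rs K))"
    by (rule sum.cong) (auto intro: bij_betw_same_card bij)
  finally show ?thesis .
qed

text \<open>A transitive irreflexive relation is acyclic, hence well founded on a finite set. With
  the relation flipped this also supplies maximal elements.\<close>

lemma ex_minimal:
  assumes "finite A" "x \<in> A" and tr: "\<And>x y z. r x y \<Longrightarrow> r y z \<Longrightarrow> r x z" and irr: "\<And>x. \<not> r x x"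
  obtains m where "m \<in> A" "\<And>y. y \<in> A \<Longrightarrow> \<not> r y m"
proof -
  have "wf {(a, b). a \<in> A \<and> b \<in> A \<and> r a b}" (is "wf ?R")
  proof (rule finite_acyclic_wf)
    show "finite ?R" by (rule finite_subset[of _ "A \<times> A"]) (use assms(1) in auto)
    have "trans ?R" using tr by (auto simp: trans_def)
    then show "acyclic ?R" unfolding acyclic_def using irr by (subst trancl_id) auto
  qed
  from wfE_min[OF this assms(2)] obtain m where "m \<in> A" "\<And>y. (y, m) \<in> ?R \<Longrightarrow> y \<notin> A" by blast
  then show ?thesis using that by blast
qed

section \<open>Invariant down-sets\<close>

locale double_poset_automorphism =
  fixes D :: "'a double_poset" and g :: "'a \<Rightarrow> 'a"
  assumes D: "double_poset D" and finite_points: "finite (points D)"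
    and special: "locally_special D" and g: "g \<in> Aut D"
begin

abbreviation N where "N \<equiv> points D"

definition ideals :: "'a set set" where
  "ideals = {I. I \<subseteq> N \<and> (\<forall>x. g x \<in> I \<longleftrightarrow> x \<in> I) \<and> (\<forall>x y. y \<in> I \<and> (x, y) \<in> ord1 D \<longrightarrow> x \<in> I)}"

definition weak :: "'a set \<Rightarrow> bool" where
  "weak X \<longleftrightarrow> (\<forall>x\<in>X. \<forall>y\<in>X. \<not> (less1 D x y \<and> less2 D y x))"

definition strict :: "'a set \<Rightarrow> bool" where
  "strict X \<longleftrightarrow> (\<forall>x\<in>X. \<forall>y\<in>X. \<not> (less1 D x y \<and> less2 D x y))"

text \<open>On a finite invariant set this is -1 to the number of \<open>g\<close>-orbits, because
  an orbit of length l contributes l to the cardinality and l - 1 transpositions to the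
  sign.\<close>

definition eps :: "'a set \<Rightarrow> 'k::field_char_0" where
  "eps X = (-1) ^ card X * of_int (sign_on X g)"

lemma g_permutes: "g permutes N"
  using g by (simp add: Aut_def)

lemma g_permutation: "permutation g"
  using g_permutes finite_points by (rule permutes_imp_permutation[rotated])

lemma ord_sub: "ord1 D \<subseteq> N \<times> N" "ord2 D \<subseteq> N \<times> N"
  using D by (auto simp: double_poset_def partial_order_on_def preorder_on_def)

lemma trans1: "trans (ord1 D)" and antisym1: "antisym (ord1 D)"
  and trans2: "trans (ord2 D)" and antisym2: "antisym (ord2 D)"
  using D by (auto simp: double_poset_def partial_order_on_def preorder_on_def)

lemma refl1: "x \<in> N \<Longrightarrow> (x, x) \<in> ord1 D"
  using D by (auto simp: double_poset_def partial_order_on_def preorder_on_def refl_on_def)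

lemma less1_trans: "less1 D x y \<Longrightarrow> less1 D y z \<Longrightarrow> less1 D x z"
  using trans1 antisym1 unfolding less1_def by (meson antisymD transD)

lemma less2_trans: "less2 D x y \<Longrightarrow> less2 D y z \<Longrightarrow> less2 D x z"
  using trans2 antisym2 unfolding less2_def by (meson antisymD transD)

lemma g_less2: "less2 D (g x) (g y) \<longleftrightarrow> less2 D x y"
proof -
  have "x \<in> N \<longleftrightarrow> g x \<in> N" "y \<in> N \<longleftrightarrow> g y \<in> N" "g x = g y \<longleftrightarrow> x = y"
    using g_permutes by (simp_all add: permutes_in_image permutes_inj inj_eq)
  then show ?thesis using g ord_sub(2) unfolding less2_def Aut_def by fastforce
qed

text \<open>Take \<open>c\<close> maximal among the elements that are at least \<open>z\<close> and
  strictly below \<open>y\<close>. Local specialness speaks of covering pairs only, so the toggling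
  argument has to pass from an arbitrary relation to a cover.\<close>

lemma cover_below:
  assumes "less1 D z y"
  obtains c where "(z, c) \<in> ord1 D" "covers1 D y c"
proof -
  have N: "less1 D a b \<Longrightarrow> a \<in> N \<and> b \<in> N" for a b using ord_sub(1) by (auto simp: less1_def)
  define A where "A = {c. (z, c) \<in> ord1 D \<and> less1 D c y}"
  have "finite A" by (rule finite_subset[OF _ finite_points]) (use N in \<open>auto simp: A_def\<close>)
  moreover have "z \<in> A" using assms N refl1 by (auto simp: A_def)
  ultimately obtain c where c: "c \<in> A" "\<And>b. b \<in> A \<Longrightarrow> \<not> less1 D c b"
    by (rule ex_minimal[where r = "\<lambda>x y. less1 D y x"]) (erule (1) less1_trans, simp add: less1_def, blast)
  have "covers1 D y c"
    unfolding covers1_def using c transD[OF trans1] by (auto simp: A_def less1_def)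
  then show ?thesis using that c(1) by (auto simp: A_def)
qed

lemma cover_above:
  assumes "less1 D y z"
  obtains c where "(c, z) \<in> ord1 D" "covers1 D c y"
proof -
  have N: "less1 D a b \<Longrightarrow> a \<in> N \<and> b \<in> N" for a b using ord_sub(1) by (auto simp: less1_def)
  define A where "A = {c. (c, z) \<in> ord1 D \<and> less1 D y c}"
  have "finite A" by (rule finite_subset[OF _ finite_points]) (use N in \<open>auto simp: A_def\<close>)
  moreover have "z \<in> A" using assms N refl1 by (auto simp: A_def)
  ultimately obtain c where c: "c \<in> A" "\<And>b. b \<in> A \<Longrightarrow> \<not> less1 D b c"
    by (rule ex_minimal[where r = "less1 D"]) (erule (1) less1_trans, simp add: less1_def, blast)
  have "covers1 D c y"
    unfolding covers1_def using c transD[OF trans1] by (auto simp: A_def less1_def)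
  then show ?thesis using that c(1) by (auto simp: A_def)
qed

lemma cover_comparable:
  assumes "covers1 D y x" shows "less2 D x y \<or> less2 D y x"
  using assms special by (auto simp: locally_special_def covers1_def less1_def less2_def)

lemma finite_ideals: "finite ideals"
  by (rule finite_subset[of _ "Pow N"]) (use finite_points in \<open>auto simp: ideals_def\<close>)

lemma ideals_finite: "I \<in> ideals \<Longrightarrow> finite I"
  using finite_points by (auto simp: ideals_def intro: finite_subset)

lemma empty_ideal: "{} \<in> ideals" and points_ideal: "N \<in> ideals"
  using g_permutes ord_sub(1) by (auto simp: ideals_def permutes_in_image)

section \<open>Signs of invariant sets and of orbits\<close>

lemma bij_betw_invariant:
  assumes "finite X" "\<And>x. g x \<in> X \<longleftrightarrow> x \<in> X" shows "bij_betw g X X"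
proof -
  have "inj_on g X" using g_permutes by (simp add: permutes_inj_on)
  moreover have "g ` X \<subseteq> X" using assms(2) by blast
  ultimately show ?thesis using assms(1) by (simp add: bij_betw_def endo_inj_surj)
qed

lemma eps_Un:
  assumes "finite X" "finite Y" "X \<inter> Y = {}"
    "\<And>x. g x \<in> X \<longleftrightarrow> x \<in> X" "\<And>x. g x \<in> Y \<longleftrightarrow> x \<in> Y"
  shows "eps (X \<union> Y) = (eps X * eps Y :: 'k::field_char_0)"
  using assms by (simp add: eps_def card_Un_disjoint power_add sign_on_Un bij_betw_invariant)

lemma eps_square: "eps X * eps X = (1 :: 'k::field_char_0)"
proof -
  have "of_int (sign_on X g) * of_int (sign_on X g) = (1 :: 'k)"
    unfolding sign_on_def by (metis of_int_1 of_int_mult sign_idempotent)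
  moreover have "(-1) ^ card X * (-1) ^ card X = (1 :: 'k)"
    by (simp add: power_mult_distrib[symmetric])
  ultimately show ?thesis unfolding eps_def by (metis mult.assoc mult.commute mult_1)
qed

lemma eps_empty [simp]: "eps {} = 1"
  by (simp add: eps_def sign_on_def restrict_id_def)

text \<open>The orbit is taken from \<open>support\<close> so that \<open>sign_on_support\<close>
  applies; \<open>orb_eq\<close> gives it as the set of iterates.\<close>

definition orb :: "'a \<Rightarrow> 'a set" where "orb x = set (support g x)"

lemma orb_eq: "orb x = range (\<lambda>i. (g ^^ i) x)"
  unfolding orb_def by (rule support_set[OF g_permutation])

lemma orb_invariant: "g y \<in> orb x \<longleftrightarrow> y \<in> orb x"
proof
  assume "y \<in> orb x"
  then obtain i where "y = (g ^^ i) x" by (auto simp: orb_eq)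
  then have "g y = (g ^^ Suc i) x" by simp
  then show "g y \<in> orb x" unfolding orb_eq by blast
next
  \<comment> \<open>The iterates are closed under \<open>g\<close> only in the forward direction; as
    an injective self-map of a finite set is onto, \<open>g\<close> maps the orbit onto
    itself.\<close>
  have fin: "finite (orb x)" by (simp add: orb_def)
  have "g ` orb x \<subseteq> orb x"
  proof safe
    fix y assume "y \<in> orb x"
    then obtain i where "y = (g ^^ i) x" by (auto simp: orb_eq)
    then have "g y = (g ^^ Suc i) x" by simp
    then show "g y \<in> orb x" unfolding orb_eq by blast
  qed
  then have "g ` orb x = orb x"
    using fin g_permutes by (intro endo_inj_surj) (auto simp: permutes_inj_on)
  moreover assume "g y \<in> orb x"
  ultimately show "y \<in> orb x" using g_permutes by (metis inj_image_mem_iff permutes_inj)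
qed

lemma eps_orb: "eps (orb x) = (-1 :: 'k::field_char_0)"
proof -
  have "card (orb x) > 0" by (simp add: orb_def card_gt_0_iff least_power_of_permutation(2)[OF g_permutation])
  then have "(-1 :: 'k) ^ card (orb x) * (-1) ^ (card (orb x) - 1) = -1"
    by (cases "card (orb x)") (simp_all add: power_mult_distrib[symmetric])
  then show ?thesis
    using sign_on_support[OF g_permutation, of x] by (simp add: eps_def orb_def del: set_map)
qed

lemma orb_disjoint_or_subset:
  assumes "\<And>y. g y \<in> K \<longleftrightarrow> y \<in> K" shows "orb x \<inter> K = {} \<or> orb x \<subseteq> K"
proof -
  have "(g ^^ i) x \<in> K \<longleftrightarrow> x \<in> K" for i by (induction i) (use assms in auto)
  then show ?thesis by (auto simp: orb_eq)
qed

section \<open>The toggling argument\<close>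

text \<open>A sign-reversing involution: the orbit of a \<open>\<le>\<^sub>2\<close>-maximal element
  of \<open>J - I\<close> is moved from \<open>K - I\<close> to \<open>J - K\<close> or back. All
  conditions on \<open>K\<close> survive, while \<open>eps (J - K)\<close> is multiplied by
  \<open>eps\<close> of one orbit, which is -1.\<close>

lemma sum_eps_eq_0:
  assumes I: "I \<in> ideals" and J: "J \<in> ideals" and IJ: "I \<subset> J"
  shows "(\<Sum>K | K \<in> ideals \<and> I \<subseteq> K \<and> K \<subseteq> J \<and> weak (K - I) \<and> strict (J - K). eps (J - K)) =
    (0 :: 'k::field_char_0)"
proof -
  have Iinv: "g x \<in> I \<longleftrightarrow> x \<in> I" and Jinv: "g x \<in> J \<longleftrightarrow> x \<in> J" for x
    using I J by (auto simp: ideals_def)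
  have Idown: "y \<in> I \<Longrightarrow> (x, y) \<in> ord1 D \<Longrightarrow> x \<in> I" for x y using I by (auto simp: ideals_def)
  have Jdown: "y \<in> J \<Longrightarrow> (x, y) \<in> ord1 D \<Longrightarrow> x \<in> J" for x y using J by (auto simp: ideals_def)
  define X where "X = J - I"
  have "finite X" using J by (simp add: X_def ideals_finite)
  moreover obtain x0 where "x0 \<in> X" using IJ by (auto simp: X_def)
  ultimately obtain x where x: "x \<in> X" "\<And>y. y \<in> X \<Longrightarrow> \<not> less2 D x y"
    by (rule ex_minimal[where r = "\<lambda>x y. less2 D y x"])
      (erule (1) less2_trans, simp add: less2_def, blast)
  define Orb where "Orb = orb x"
  have "x \<in> Orb" unfolding Orb_def orb_eq by (metis funpow_0 rangeI)
  have finO: "finite Orb" by (simp add: Orb_def orb_def)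
  have Oinv: "g y \<in> Orb \<longleftrightarrow> y \<in> Orb" for y by (simp add: Orb_def orb_invariant)
  \<comment> \<open>Since \<open>g\<close> preserves \<open>X\<close> and the second order,
    maximality spreads from \<open>x\<close> to its whole orbit.\<close>
  have max: "y \<in> X \<and> (\<forall>z\<in>X. \<not> less2 D y z)" if "y \<in> Orb" for y
  proof -
    have Xinv: "g z \<in> X \<longleftrightarrow> z \<in> X" for z using Iinv Jinv by (simp add: X_def)
    have "(g ^^ i) x \<in> X \<and> (\<forall>z\<in>X. \<not> less2 D ((g ^^ i) x) z)" for i
    proof (induction i)
      case (Suc i)
      have "\<not> less2 D (g ((g ^^ i) x)) z" if "z \<in> X" for z
      proof -
        obtain z' where "z = g z'" using g_permutes by (metis permutes_def)
        then show ?thesis using Suc that Xinv g_less2 by metis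
      qed
      then show ?case using Suc Xinv by simp
    qed (use x in simp)
    then show ?thesis using that by (auto simp: Orb_def orb_eq)
  qed
  have OX: "Orb \<subseteq> X" using max by blast
  define V where "V K \<longleftrightarrow> K \<in> ideals \<and> I \<subseteq> K \<and> K \<subseteq> J \<and> weak (K - I) \<and> strict (J - K)" for K
  define A where "A = {K. V K \<and> Orb \<subseteq> K}"
  define B where "B = {K. V K \<and> Orb \<inter> K = {}}"
  have remove: "V (K - Orb)" if "V K" "Orb \<subseteq> K" for K
  proof -
    have K: "K \<in> ideals" "I \<subseteq> K" "K \<subseteq> J" "weak (K - I)" "strict (J - K)" using that by (auto simp: V_def)
    have Kdown: "y \<in> K \<Longrightarrow> (x, y) \<in> ord1 D \<Longrightarrow> x \<in> K" for x y using K by (auto simp: ideals_def)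
    \<comment> \<open>If \<open>z\<close> in \<open>Orb\<close> lay below a \<open>y\<close> that
      stays, some cover \<open>c\<close> of \<open>z\<close> below \<open>y\<close> would lie in
      \<open>K - I\<close>. Maximality of \<open>z\<close> excludes \<open>less2 D z c\<close>, so
      local specialness leaves \<open>less2 D c z\<close>, and weakness of \<open>K - I\<close>
      forbids this.\<close>
    have "z \<notin> Orb" if y: "y \<in> K - Orb" and zy: "(z, y) \<in> ord1 D" for z y
    proof
      assume z: "z \<in> Orb"
      then have "less1 D z y" using y zy by (auto simp: less1_def)
      then obtain c where c: "(c, y) \<in> ord1 D" "covers1 D c z" by (rule cover_above)
      have zc: "less1 D z c" using c(2) by (simp add: covers1_def)
      have "c \<in> K" using Kdown c y by blast
      moreover have "c \<notin> I" using Idown zc max[OF z] by (auto simp: X_def less1_def)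
      ultimately have cX: "c \<in> K - I" "c \<in> X" using K by (auto simp: X_def)
      have "z \<in> K - I" using z max[OF z] that \<open>Orb \<subseteq> K\<close> by (auto simp: X_def)
      then show False
        using cover_comparable[OF c(2)] max[OF z] cX zc K(4) by (auto simp: weak_def)
    qed
    then have "K - Orb \<in> ideals" using K(1) Oinv by (auto simp: ideals_def)
    \<comment> \<open>In an offending pair \<open>i\<close>, \<open>j\<close> the lower element
      \<open>i\<close> is not in \<open>Orb\<close> by maximality, so it is outside
      \<open>K\<close>. Strictness of \<open>J - K\<close> then puts \<open>j\<close> into
      \<open>K\<close>, contradicting that \<open>K\<close> is a down-set.\<close>
    moreover have "strict (J - (K - Orb))"
      unfolding strict_def
    proof (intro ballI notI)
      fix i j assume i: "i \<in> J - (K - Orb)" and j: "j \<in> J - (K - Orb)"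
        and less: "less1 D i j \<and> less2 D i j"
      have "j \<notin> I" using j max K(2) by (auto simp: X_def)
      then have "i \<notin> Orb" using max[of i] j less by (auto simp: X_def)
      then have iK: "i \<in> J - K" using i by blast
      then have "j \<in> K" using j less K(5) by (auto simp: strict_def)
      then show False using iK less Kdown by (auto simp: less1_def)
    qed
    moreover have "weak (K - Orb - I)" using K(4) by (auto simp: weak_def)
    ultimately show ?thesis using K OX by (auto simp: V_def X_def)
  qed
  have add: "V (K \<union> Orb)" if "V K" "Orb \<inter> K = {}" for K
  proof -
    have K: "K \<in> ideals" "I \<subseteq> K" "K \<subseteq> J" "weak (K - I)" "strict (J - K)" using that by (auto simp: V_def)
    have Kdown: "y \<in> K \<Longrightarrow> (x, y) \<in> ord1 D \<Longrightarrow> x \<in> K" for x y using K by (auto simp: ideals_def)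
    \<comment> \<open>If \<open>z\<close> below \<open>y\<close> were missing, \<open>y\<close>
      would cover some \<open>c\<close> above or equal to \<open>z\<close>, also missing from
      \<open>K\<close>. Maximality of \<open>y\<close> and local specialness force
      \<open>less2 D c y\<close>, against strictness of \<open>J - K\<close>.\<close>
    have down: "z \<in> K \<union> Orb" if y: "y \<in> Orb" and zy: "(z, y) \<in> ord1 D" for z y
    proof (rule ccontr)
      assume z: "z \<notin> K \<union> Orb"
      then have "less1 D z y" using y zy by (auto simp: less1_def)
      then obtain c where c: "(z, c) \<in> ord1 D" "covers1 D y c" by (rule cover_below)
      have cy: "less1 D c y" using c(2) by (simp add: covers1_def)
      have "c \<in> J - K" using Kdown c(1) z Jdown cy max[OF y] by (auto simp: X_def less1_def)
      moreover have "y \<in> J - K" using y \<open>Orb \<inter> K = {}\<close> OX by (auto simp: X_def)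
      ultimately show False
        using cover_comparable[OF c(2)] max[OF y] cy K(2,5) by (auto simp: strict_def X_def)
    qed
    then have "K \<union> Orb \<in> ideals" using K(1) Oinv OX J by (auto simp: ideals_def X_def)
    moreover have "weak (K \<union> Orb - I)"
      unfolding weak_def
    proof (intro ballI notI)
      fix i j assume i: "i \<in> K \<union> Orb - I" and j: "j \<in> K \<union> Orb - I"
        and less: "less1 D i j \<and> less2 D j i"
      have "j \<notin> Orb" using max[of j] i less K(3) OX by (auto simp: X_def)
      then have jK: "j \<in> K - I" using j by blast
      then have "i \<in> K" using less Kdown by (auto simp: less1_def)
      then show False using i jK less K(4) by (auto simp: weak_def)
    qed
    moreover have "strict (J - (K \<union> Orb))" using K(5) by (auto simp: strict_def)
    ultimately show ?thesis using K OX by (auto simp: V_def X_def)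
  qed
  have "bij_betw (\<lambda>K. K - Orb) A B"
    by (rule bij_betw_byWitness[where f' = "\<lambda>K. K \<union> Orb"]) (auto simp: A_def B_def remove add)
  then have "(\<Sum>K\<in>B. eps (J - K)) = (\<Sum>K\<in>A. eps (J - (K - Orb)) :: 'k)"
    by (rule sum.reindex_bij_betw[symmetric])
  also have "\<dots> = (\<Sum>K\<in>A. - eps (J - K))"
  proof (rule sum.cong[OF refl])
    fix K assume "K \<in> A"
    then have K: "V K" "Orb \<subseteq> K" by (auto simp: A_def)
    have Kinv: "g y \<in> K \<longleftrightarrow> y \<in> K" for y using K by (auto simp: V_def ideals_def)
    have "J - (K - Orb) = (J - K) \<union> Orb" using OX by (auto simp: X_def)
    moreover have "eps ((J - K) \<union> Orb) = (eps (J - K) * eps Orb :: 'k)"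
      using J finO K(2) Kinv Jinv Oinv by (intro eps_Un) (auto simp: ideals_finite)
    ultimately show "eps (J - (K - Orb)) = (- eps (J - K) :: 'k)" by (simp add: Orb_def eps_orb)
  qed
  finally have *: "(\<Sum>K\<in>B. eps (J - K)) = (- (\<Sum>K\<in>A. eps (J - K)) :: 'k)"
    by (simp add: sum_negf)
  \<comment> \<open>An invariant \<open>K\<close> contains the orbit or misses it, so the two
    families matched by the toggle exhaust the index set.\<close>
  have "{K. V K} = A \<union> B"
    using orb_disjoint_or_subset[of _ x] by (auto simp: A_def B_def V_def ideals_def Orb_def)
  moreover have "finite A" "finite B"
    using finite_ideals by (auto simp: A_def B_def V_def intro: finite_subset[rotated])
  moreover have "A \<inter> B = {}" using \<open>x \<in> Orb\<close> by (auto simp: A_def B_def)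
  ultimately have "(\<Sum>K | V K. eps (J - K)) = (0 :: 'k)" by (simp add: sum.union_disjoint *)
  then show ?thesis by (simp add: V_def)
qed

section \<open>Graded weak and strict layer operators, and their inversion\<close>

definition layer :: "('a set \<Rightarrow> bool) \<Rightarrow> nat set \<Rightarrow> 'a set \<Rightarrow> 'a set \<Rightarrow> bool" where
  "layer ok C I K \<longleftrightarrow> I \<subseteq> K \<and> ok (K - I) \<and> card (K - I) \<in> C"

text \<open>For \<open>ok = weak\<close> this is the matrix \<open>A\<close> applied to the vector
  \<open>\<phi>\<close>, cut down to layers whose size lies in \<open>C\<close>: singletons give the
  graded pieces, \<open>UNIV\<close> the whole matrix.\<close>

definition sum_layers ::
  "('a set \<Rightarrow> bool) \<Rightarrow> nat set \<Rightarrow> ('a set \<Rightarrow> 'k::field_char_0) \<Rightarrow> 'a set \<Rightarrow> 'k" where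
  "sum_layers ok C \<phi> I = (\<Sum>K\<in>ideals. of_bool (layer ok C I K) * \<phi> K)"

text \<open>The matrix \<open>B\<close> applied to \<open>\<phi>\<close>, graded in the same
  way.\<close>

definition signed_layers ::
  "nat set \<Rightarrow> ('a set \<Rightarrow> 'k::field_char_0) \<Rightarrow> 'a set \<Rightarrow> 'k" where
  "signed_layers C \<phi> I = sum_layers strict C (\<lambda>K. eps (K - I) * \<phi> K) I"

lemma sum_layers_cong:
  "(\<And>K. K \<in> ideals \<Longrightarrow> \<phi> K = \<psi> K) \<Longrightarrow> sum_layers ok C \<phi> I = sum_layers ok C \<psi> I"
  by (simp add: sum_layers_def)

lemma layer_0: "ok {} \<Longrightarrow> K \<in> ideals \<Longrightarrow> layer ok {0} I K \<longleftrightarrow> K = I"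
  using ideals_finite by (auto simp: layer_def)

lemma sum_layers_0:
  assumes "ok {}" "I \<in> ideals" shows "sum_layers ok {0} \<phi> I = \<phi> I"
proof -
  have "sum_layers ok {0} \<phi> I = (\<Sum>K\<in>ideals. if K = I then \<phi> K else 0)"
    unfolding sum_layers_def by (rule sum.cong) (simp_all add: layer_0 assms(1))
  then show ?thesis using assms finite_ideals by simp
qed

lemma weak_empty: "weak {}" and strict_empty: "strict {}"
  by (simp_all add: weak_def strict_def)

lemma signed_layers_0: "I \<in> ideals \<Longrightarrow> signed_layers {0} \<phi> I = \<phi> I"
  by (simp add: signed_layers_def sum_layers_0 strict_empty)

lemma sum_eps_interval:
  assumes I: "I \<in> ideals" and J: "J \<in> ideals"
  shows "(\<Sum>K | K \<in> ideals \<and> I \<subseteq> K \<and> K \<subseteq> J \<and> weak (K - I) \<and> strict (J - K). eps (J - K)) =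
    (of_bool (I = J) :: 'k::field_char_0)"
proof (cases "I \<subset> J")
  case True
  then show ?thesis using sum_eps_eq_0[OF I J] by auto
next
  case False
  have "{K. K \<in> ideals \<and> I \<subseteq> K \<and> K \<subseteq> J \<and> weak (K - I) \<and> strict (J - K)} = (if I = J then {J} else {})"
    using False I by (auto simp: weak_empty strict_empty)
  then show ?thesis by simp
qed

text \<open>One statement serves the graded and the ungraded inversion. The layer sizes add up to
  \<open>card (J - I)\<close>, so \<open>split\<close> merges all size conditions into one on
  \<open>J - I\<close>, which factors out of the sum over \<open>K\<close>. By
  \<open>sum_eps_interval\<close> only \<open>J = I\<close> survives.\<close>

lemma sum_layers_signed_layers:
  fixes \<phi> :: "'a set \<Rightarrow> 'k::field_char_0"
  assumes I: "I \<in> ideals" and T: "finite T"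
    and split: "\<And>p q. (\<Sum>t\<in>T. of_bool (p \<in> C t \<and> q \<in> E t)) = (of_bool (p + q \<in> Q) :: 'k)"
  shows "(\<Sum>t\<in>T. sum_layers weak (C t) (signed_layers (E t) \<phi>) I) = of_bool (0 \<in> Q) * \<phi> I"
proof -
  let ?w = "\<lambda>K J. K \<in> ideals \<and> I \<subseteq> K \<and> K \<subseteq> J \<and> weak (K - I) \<and> strict (J - K)"
  have "(\<Sum>t\<in>T. sum_layers weak (C t) (signed_layers (E t) \<phi>) I) =
      (\<Sum>t\<in>T. \<Sum>K\<in>ideals. \<Sum>J\<in>ideals.
        of_bool (layer weak (C t) I K) * (of_bool (layer strict (E t) K J) * (eps (J - K) * \<phi> J)))"
    by (simp only: sum_layers_def signed_layers_def sum_distrib_left)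
  also have "\<dots> = (\<Sum>t\<in>T. \<Sum>J\<in>ideals. \<Sum>K\<in>ideals.
        of_bool (layer weak (C t) I K) * (of_bool (layer strict (E t) K J) * (eps (J - K) * \<phi> J)))"
    by (rule sum.cong[OF refl], rule sum.swap)
  also have "\<dots> = (\<Sum>J\<in>ideals. \<Sum>t\<in>T. \<Sum>K\<in>ideals.
        of_bool (layer weak (C t) I K) * (of_bool (layer strict (E t) K J) * (eps (J - K) * \<phi> J)))"
    by (rule sum.swap)
  also have "\<dots> = (\<Sum>J\<in>ideals. \<Sum>K\<in>ideals. \<Sum>t\<in>T.
        of_bool (layer weak (C t) I K) * (of_bool (layer strict (E t) K J) * (eps (J - K) * \<phi> J)))"
    by (rule sum.cong[OF refl], rule sum.swap)
  also have "\<dots> = (\<Sum>J\<in>ideals. \<Sum>K\<in>ideals.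
        of_bool (card (J - I) \<in> Q) * \<phi> J * (if ?w K J then eps (J - K) else 0))"
  proof (intro sum.cong refl)
    fix J K assume J: "J \<in> ideals" and K: "K \<in> ideals"
    show "(\<Sum>t\<in>T. of_bool (layer weak (C t) I K) * (of_bool (layer strict (E t) K J) * (eps (J - K) * \<phi> J)))
      = of_bool (card (J - I) \<in> Q) * \<phi> J * (if ?w K J then eps (J - K) else 0)"
    proof (cases "?w K J")
      case True
      have "J - I = (K - I) \<union> (J - K)" using True by blast
      moreover have "card ((K - I) \<union> (J - K)) = card (K - I) + card (J - K)"
        using J K by (intro card_Un_disjoint) (auto simp: ideals_finite)
      ultimately have card: "card (K - I) + card (J - K) = card (J - I)" by simp
      have "(\<Sum>t\<in>T. of_bool (layer weak (C t) I K) * (of_bool (layer strict (E t) K J) * (eps (J - K) * \<phi> J)))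
        = (\<Sum>t\<in>T. of_bool (card (K - I) \<in> C t \<and> card (J - K) \<in> E t)) * (eps (J - K) * \<phi> J)"
        unfolding sum_distrib_right by (rule sum.cong) (use True in \<open>auto simp: layer_def\<close>)
      also have "\<dots> = of_bool (card (J - I) \<in> Q) * (eps (J - K) * \<phi> J)"
        by (simp only: split card)
      finally show ?thesis using True by simp
    next
      case False
      then have "\<not> (layer weak (C t) I K \<and> layer strict (E t) K J)" for t
        using K by (auto simp: layer_def)
      then have "(\<Sum>t\<in>T. of_bool (layer weak (C t) I K) *
          (of_bool (layer strict (E t) K J) * (eps (J - K) * \<phi> J))) = 0"
        by (intro sum.neutral) auto
      then show ?thesis using False by auto
    qed
  qed
  also have "\<dots> = (\<Sum>J\<in>ideals. of_bool (card (J - I) \<in> Q) * \<phi> J * (\<Sum>K | ?w K J. eps (J - K)))"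
  proof (rule sum.cong[OF refl])
    fix J
    have "{K \<in> ideals. ?w K J} = {K. ?w K J}" by auto
    then show "(\<Sum>K\<in>ideals. of_bool (card (J - I) \<in> Q) * \<phi> J * (if ?w K J then eps (J - K) else 0)) =
        of_bool (card (J - I) \<in> Q) * \<phi> J * (\<Sum>K | ?w K J. eps (J - K))"
      unfolding sum_distrib_left[symmetric] sum.inter_filter[OF finite_ideals, symmetric] by simp
  qed
  also have "\<dots> = (\<Sum>J\<in>ideals. if J = I then of_bool (0 \<in> Q) * \<phi> J else 0)"
    by (rule sum.cong) (auto simp: sum_eps_interval[OF I])
  also have "\<dots> = of_bool (0 \<in> Q) * \<phi> I" using I finite_ideals by simp
  finally show ?thesis .
qed

lemma sum_layers_signed_layers_UNIV:
  assumes "I \<in> ideals"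
  shows "sum_layers weak UNIV (signed_layers UNIV \<phi>) I = \<phi> I"
  using sum_layers_signed_layers[OF assms, of "{()}" "\<lambda>_. UNIV" "\<lambda>_. UNIV" UNIV \<phi>] by simp

text \<open>This is the degree \<open>b\<close> part of the inversion, which vanishes as
  \<open>b > 0\<close>. The term with \<open>a = 0\<close> is
  \<open>signed_layers {b} \<phi> I\<close> itself, because empty layers act as the identity; it is
  moved to the other side.\<close>

lemma signed_layers_rec:
  assumes "I \<in> ideals" "b > 0"
  shows "signed_layers {b} \<phi> I = - (\<Sum>a=1..b. sum_layers weak {a} (signed_layers {b - a} \<phi>) I)"
proof -
  have "(\<Sum>a\<in>{..b}. of_bool (p \<in> {a} \<and> q \<in> {b - a})) = (of_bool (p + q \<in> {b}) :: 'b)" for p q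
  proof -
    have "(\<Sum>a\<in>{..b}. of_bool (p \<in> {a} \<and> q \<in> {b - a})) =
      (\<Sum>a\<in>{..b}. if a = p then of_bool (q = b - p) else (0::'b))"
      by (rule sum.cong) auto
    then show ?thesis by auto
  qed
  from sum_layers_signed_layers[OF assms(1) _ this, of \<phi>]
  have "(\<Sum>a\<in>{0..b}. sum_layers weak {a} (signed_layers {b - a} \<phi>) I) = 0"
    using assms(2) by (simp add: atMost_atLeast0)
  then have "sum_layers weak {0} (signed_layers {b} \<phi>) I +
      (\<Sum>a=1..b. sum_layers weak {a} (signed_layers {b - a} \<phi>) I) = 0"
    by (subst (asm) sum.atLeast_Suc_atMost) simp_all
  then show ?thesis
    by (simp add: sum_layers_0 weak_empty assms(1) eq_neg_iff_add_eq_0)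
qed

section \<open>The antipode\<close>

text \<open>The basis vector at the full set: operators applied to it sum over chains that end in
  \<open>N\<close>.\<close>

definition delta :: "'a set \<Rightarrow> 'k::field_char_0" where
  "delta I = of_bool (I = N)"

text \<open>Iterating \<open>signed_layers_rec\<close> writes each graded piece of \<open>B\<close>
  as an alternating sum over the compositions of its degree; concatenating such compositions for the
  parts of \<open>\<beta>\<close> yields the refinements of \<open>\<beta>\<close>. The induction is
  on the sum because splitting off a first part need not shorten the list.\<close>

lemma foldr_signed_layers_refinements:
  fixes \<phi> :: "'a set \<Rightarrow> 'k::field_char_0"
  assumes "composition \<beta>" "I \<in> ideals"
  shows "(\<Sum>\<alpha>\<in>refinements \<beta>. (-1) ^ length \<alpha> * foldr (\<lambda>a. sum_layers weak {a}) \<alpha> \<phi> I) =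
    foldr (\<lambda>b. signed_layers {b}) \<beta> \<phi> I"
  using assms
proof (induction "sum_list \<beta>" arbitrary: \<beta> I rule: less_induct)
  case less
  show ?case
  proof (cases \<beta>)
    case Nil
    then show ?thesis by (simp add: refinements_Nil)
  next
    case (Cons b \<beta>')
    have b: "0 < b" and \<beta>': "composition \<beta>'" using less.prems(1) Cons by (auto simp: composition_def)
    define \<psi> where "\<psi> \<alpha> = foldr (\<lambda>a. sum_layers weak {a}) \<alpha> \<phi>" for \<alpha>
    define \<beta>s where "\<beta>s a = (if a = b then \<beta>' else (b - a) # \<beta>')" for a
    have "(\<Sum>\<alpha>\<in>refinements \<beta>. (-1) ^ length \<alpha> * \<psi> \<alpha> I) =
        (\<Sum>(a, \<alpha>)\<in>(SIGMA a:{1..b}. refinements (\<beta>s a)). (-1) ^ Suc (length \<alpha>) * \<psi> (a # \<alpha>) I)"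
      unfolding Cons refinements_Cons[OF b] \<beta>s_def
      by (subst sum.reindex) (auto simp: inj_on_def case_prod_unfold)
    also have "\<dots> = (\<Sum>a=1..b. \<Sum>\<alpha>\<in>refinements (\<beta>s a). (-1) ^ Suc (length \<alpha>) * \<psi> (a # \<alpha>) I)"
      by (rule sum.Sigma[symmetric]) (simp_all add: finite_refinements)
    also have "\<dots> = (\<Sum>a=1..b. - sum_layers weak {a} (signed_layers {b - a} (foldr (\<lambda>b. signed_layers {b}) \<beta>' \<phi>)) I)"
    proof (rule sum.cong[OF refl])
      fix a assume a: "a \<in> {1..b}"
      have *: "(\<Sum>\<alpha>\<in>refinements (\<beta>s a). (-1) ^ length \<alpha> * \<psi> \<alpha> K) =
          signed_layers {b - a} (foldr (\<lambda>b. signed_layers {b}) \<beta>' \<phi>) K" if K: "K \<in> ideals" for K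
      proof -
        have "sum_list (\<beta>s a) < sum_list \<beta>" "composition (\<beta>s a)"
          using a b \<beta>' by (auto simp: \<beta>s_def Cons composition_def)
        from less.hyps[OF this K] have "(\<Sum>\<alpha>\<in>refinements (\<beta>s a). (-1) ^ length \<alpha> * \<psi> \<alpha> K) =
          foldr (\<lambda>b. signed_layers {b}) (\<beta>s a) \<phi> K" by (simp add: \<psi>_def)
        \<comment> \<open>For \<open>a = b\<close> the part is dropped rather than replaced by
          \<open>0\<close>; this agrees because \<open>signed_layers {0}\<close> is the identity on
          ideals.\<close>
        then show ?thesis by (auto simp: \<beta>s_def signed_layers_0[OF K])
      qed
      have "(\<Sum>\<alpha>\<in>refinements (\<beta>s a). (-1) ^ Suc (length \<alpha>) * \<psi> (a # \<alpha>) I) =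
          - (\<Sum>\<alpha>\<in>refinements (\<beta>s a). \<Sum>K\<in>ideals. of_bool (layer weak {a} I K) * ((-1) ^ length \<alpha> * \<psi> \<alpha> K))"
        by (simp add: \<psi>_def sum_layers_def sum_negf sum_distrib_left algebra_simps)
      also have "\<dots> = - (\<Sum>K\<in>ideals. of_bool (layer weak {a} I K) * (\<Sum>\<alpha>\<in>refinements (\<beta>s a). (-1) ^ length \<alpha> * \<psi> \<alpha> K))"
        by (subst sum.swap) (simp add: sum_distrib_left)
      also have "\<dots> = - sum_layers weak {a} (signed_layers {b - a} (foldr (\<lambda>b. signed_layers {b}) \<beta>' \<phi>)) I"
        by (simp add: sum_layers_def * cong: sum.cong)
      finally show "(\<Sum>\<alpha>\<in>refinements (\<beta>s a). (-1) ^ Suc (length \<alpha>) * \<psi> (a # \<alpha>) I) = \<dots>" .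
    qed
    also have "\<dots> = foldr (\<lambda>b. signed_layers {b}) \<beta> \<phi> I"
      by (simp add: Cons signed_layers_rec[OF less.prems(2) b] sum_negf)
    finally show ?thesis by (simp add: \<psi>_def)
  qed
qed

text \<open>The signs of the layers multiply along a chain from \<open>I\<close> to
  \<open>N\<close>, and by \<open>eps_Un\<close> the product depends only on its ends.\<close>

lemma foldr_signed_layers_delta:
  assumes "I \<in> ideals"
  shows "foldr signed_layers Cs delta I = eps (N - I) * (foldr (sum_layers strict) Cs delta I :: 'k::field_char_0)"
  using assms
proof (induction Cs arbitrary: I)
  case Nil
  then show ?case by (simp add: delta_def)
next
  case (Cons C Cs)
  have "eps (K - I) * foldr signed_layers Cs delta K =
      (eps (N - I) * foldr (sum_layers strict) Cs delta K :: 'k)" if "K \<in> ideals" "I \<subseteq> K" for K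
  proof -
    have "N - I = (K - I) \<union> (N - K)" using that Cons.prems by (auto simp: ideals_def)
    moreover have "eps ((K - I) \<union> (N - K)) = (eps (K - I) * eps (N - K) :: 'k)"
      using that Cons.prems points_ideal ideals_finite finite_points
      by (intro eps_Un) (auto simp: ideals_def)
    ultimately show ?thesis using Cons.IH[OF that(1)] by simp
  qed
  then have *: "of_bool (layer strict C I K) * (eps (K - I) * foldr signed_layers Cs delta K) =
      (eps (N - I) * (of_bool (layer strict C I K) * foldr (sum_layers strict) Cs delta K) :: 'k)"
    if "K \<in> ideals" for K
    using that by (auto simp: layer_def)
  have "foldr signed_layers (C # Cs) delta I =
      (\<Sum>K\<in>ideals. of_bool (layer strict C I K) * (eps (K - I) * foldr signed_layers Cs delta K) :: 'k)"
    by (simp add: signed_layers_def[of C] sum_layers_def[of strict C])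
  also have "\<dots> = (\<Sum>K\<in>ideals. eps (N - I) *
      (of_bool (layer strict C I K) * foldr (sum_layers strict) Cs delta K))"
    by (rule sum.cong[OF refl *])
  also have "\<dots> = eps (N - I) * foldr (sum_layers strict) (C # Cs) delta I"
    by (simp add: sum_layers_def[of strict C] sum_distrib_left)
  finally show ?case .
qed

section \<open>Partitions as chains of invariant down-sets\<close>

definition layer_rel :: "('a set \<Rightarrow> bool) \<Rightarrow> nat set \<Rightarrow> 'a set \<Rightarrow> 'a set \<Rightarrow> bool" where
  "layer_rel ok C I K \<longleftrightarrow> K \<in> ideals \<and> layer ok C I K"

text \<open>Each operator chooses the next set of a chain, as in \<open>card_layered_Cons\<close>,
  and \<open>delta\<close> requires the last one to be \<open>N\<close>. That every chosen set is an
  ideal is part of \<open>layer_rel\<close>, since \<open>layered\<close> ranges over arbitrary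
  subsets.\<close>

lemma foldr_sum_layers_delta:
  assumes "I \<subseteq> N"
  shows "foldr (sum_layers ok) Cs delta I = (of_nat (card (layered N (map (layer_rel ok) Cs) I)) :: 'k::field_char_0)"
  using assms
proof (induction Cs arbitrary: I)
  case Nil
  then show ?case by (simp add: delta_def card_layered_Nil)
next
  case (Cons C Cs)
  have "{K. K \<subseteq> N \<and> I \<subseteq> K \<and> layer_rel ok C I K} = {K \<in> ideals. layer ok C I K}"
    by (auto simp: layer_rel_def layer_def ideals_def)
  then have "of_nat (card (layered N (map (layer_rel ok) (C # Cs)) I)) =
      (\<Sum>K | K \<in> ideals \<and> layer ok C I K. of_nat (card (layered N (map (layer_rel ok) Cs) K)) :: 'k)"
    by (simp add: card_layered_Cons[OF finite_points Cons.prems])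
  also have "\<dots> = (\<Sum>K | K \<in> ideals \<and> layer ok C I K. foldr (sum_layers ok) Cs delta K)"
    by (rule sum.cong) (auto simp: Cons.IH ideals_def)
  also have "\<dots> = foldr (sum_layers ok) (C # Cs) delta I"
    unfolding sum.inter_filter[OF finite_ideals]
    by (simp add: sum_layers_def) (rule sum.cong, auto)
  finally show ?case ..
qed

lemma ideal_invariant: "I \<in> ideals \<Longrightarrow> g x \<in> I \<longleftrightarrow> x \<in> I"
  by (simp add: ideals_def)

lemma ideal_down: "I \<in> ideals \<Longrightarrow> y \<in> I \<Longrightarrow> (x, y) \<in> ord1 D \<Longrightarrow> x \<in> I"
  by (auto simp: ideals_def)

text \<open>Sublevel sets are invariant exactly when \<open>f\<close> is, and down-sets exactly when
  \<open>f\<close> is monotone. The empty initial set excludes the value \<open>0\<close>, and layer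
  \<open>j\<close> is the level set of \<open>Suc j\<close>.\<close>

lemma layered_ideals_eq:
  "layered N (map (layer_rel ok) Cs) {} =
    {f \<in> N \<rightarrow>\<^sub>E {1..length Cs}. (\<forall>x. f (g x) = f x) \<and> (\<forall>x y. (x, y) \<in> ord1 D \<longrightarrow> f x \<le> f y) \<and>
      (\<forall>j<length Cs. ok {x\<in>N. f x = Suc j} \<and> card {x\<in>N. f x = Suc j} \<in> Cs ! j)}" (is "?L = ?R")
proof -
  have level: "{x\<in>N. f x \<le> Suc j} - {x\<in>N. f x \<le> j} = {x\<in>N. f x = Suc j}" for f :: "'a \<Rightarrow> nat" and j
    by auto
  have layer_iff: "layer_rel ok C {x\<in>N. f x \<le> j} {x\<in>N. f x \<le> Suc j} \<longleftrightarrow>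
      {x\<in>N. f x \<le> Suc j} \<in> ideals \<and> ok {x\<in>N. f x = Suc j} \<and> card {x\<in>N. f x = Suc j} \<in> C" for f C j
    unfolding layer_rel_def layer_def level by auto
  have gN: "g x \<in> N \<longleftrightarrow> x \<in> N" for x using g_permutes by (simp add: permutes_in_image)
  show ?thesis
  proof (intro equalityI subsetI)
    fix f assume "f \<in> ?L"
    then have f: "f \<in> N \<rightarrow>\<^sub>E {..length Cs}" "\<forall>x\<in>N. f x \<noteq> 0"
      and lev: "\<forall>j<length Cs. {x\<in>N. f x \<le> Suc j} \<in> ideals \<and> ok {x\<in>N. f x = Suc j} \<and>
        card {x\<in>N. f x = Suc j} \<in> Cs ! j"
      by (auto simp: layered_def layer_iff)
    have pos: "1 \<le> f x" "f x \<le> length Cs" if "x \<in> N" for x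
    proof -
      show "1 \<le> f x" using bspec[OF f(2) that] by simp
      show "f x \<le> length Cs" using PiE_mem[OF f(1) that] by simp
    qed
    have ideal: "{x\<in>N. f x \<le> f y} \<in> ideals" if "y \<in> N" for y
    proof -
      have y: "1 \<le> f y" "f y \<le> length Cs" using pos[OF that] by auto
      then obtain k where "f y = Suc k" by (cases "f y") auto
      moreover from this have "k < length Cs" using y by simp
      ultimately show ?thesis using lev by metis
    qed
    have "f (g x) = f x" for x
    proof (cases "x \<in> N")
      case True
      then have gx: "g x \<in> N" using gN by simp
      \<comment> \<open>The sublevel set at \<open>f x\<close> contains \<open>g x\<close> and the
        one at \<open>f (g x)\<close> contains \<open>x\<close>, so each value bounds the
        other.\<close>
      show ?thesis
        using ideal_invariant[OF ideal[OF True], of x] ideal_invariant[OF ideal[OF gx], of x] True gx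
        by simp
    next
      case False
      then show ?thesis using g_permutes by (simp add: permutes_not_in)
    qed
    moreover have "f x \<le> f y" if "(x, y) \<in> ord1 D" for x y
    proof -
      have "y \<in> N" using that ord_sub(1) by blast
      then show ?thesis using ideal_down[OF ideal[of y], of y x] that by simp
    qed
    moreover have "f \<in> N \<rightarrow>\<^sub>E {1..length Cs}"
      using f(1) pos by (auto simp: PiE_iff)
    ultimately show "f \<in> ?R" using lev by blast
  next
    fix f assume f: "f \<in> ?R"
    then have range: "f x \<in> {1..length Cs}" if "x \<in> N" for x using that by blast
    have "{x\<in>N. f x \<le> j} \<in> ideals" for j
      using f gN ord_sub(1) by (fastforce simp: ideals_def)
    then show "f \<in> ?L" using f range by (auto simp: layered_def layer_iff PiE_iff Suc_le_eq)
  qed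
qed

text \<open>For a monotone \<open>f\<close> a required strict inequality can fail only by equality,
  that is, inside one level set; this is weakness of the level sets.\<close>

lemma fixed_D_partitions_layered:
  "{f \<in> fixed_D_partitions D g. f ` N \<subseteq> {1..length Cs} \<and>
      (\<forall>j<length Cs. card {x\<in>N. f x = Suc j} \<in> Cs ! j)} = layered N (map (layer_rel weak) Cs) {}"
proof -
  have levels: "(\<forall>j<length Cs. weak {x\<in>N. f x = Suc j}) \<longleftrightarrow> (\<forall>i j. less1 D i j \<and> less2 D j i \<longrightarrow> f i < f j)"
    if f: "f \<in> N \<rightarrow>\<^sub>E {1..length Cs}" "\<forall>x y. (x, y) \<in> ord1 D \<longrightarrow> f x \<le> f y" for f
  proof
    assume *: "\<forall>j<length Cs. weak {x\<in>N. f x = Suc j}"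
    show "\<forall>i j. less1 D i j \<and> less2 D j i \<longrightarrow> f i < f j"
    proof (intro allI impI, rule ccontr)
      fix i j assume ij: "less1 D i j \<and> less2 D j i" "\<not> f i < f j"
      then have "i \<in> N" "j \<in> N" "f i = f j"
        using f(2) ord_sub(1) by (auto simp: less1_def intro!: antisym)
      moreover from \<open>i \<in> N\<close> obtain k where "k < length Cs" "f i = Suc k"
        using PiE_mem[OF f(1)] by (cases "f i") fastforce+
      ultimately show False using * ij(1) unfolding weak_def by auto
    qed
  qed (fastforce simp: weak_def)
  show ?thesis
  proof (rule set_eqI)
    fix f
    have "f \<in> {f \<in> fixed_D_partitions D g. f ` N \<subseteq> {1..length Cs} \<and>
        (\<forall>j<length Cs. card {x\<in>N. f x = Suc j} \<in> Cs ! j)} \<longleftrightarrow>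
      f \<in> N \<rightarrow>\<^sub>E {1..length Cs} \<and> (\<forall>x. f (g x) = f x) \<and> (\<forall>x y. (x, y) \<in> ord1 D \<longrightarrow> f x \<le> f y) \<and>
      (\<forall>i j. less1 D i j \<and> less2 D j i \<longrightarrow> f i < f j) \<and>
      (\<forall>j<length Cs. card {x\<in>N. f x = Suc j} \<in> Cs ! j)"
      by (auto simp: fixed_D_partitions_def D_partitions_def fun_eq_iff PiE_iff image_subset_iff)
    then show "f \<in> {f \<in> fixed_D_partitions D g. f ` N \<subseteq> {1..length Cs} \<and>
        (\<forall>j<length Cs. card {x\<in>N. f x = Suc j} \<in> Cs ! j)} \<longleftrightarrow>
      f \<in> layered N (map (layer_rel weak) Cs) {}"
      unfolding layered_ideals_eq mem_Collect_eq using levels[of f] by blast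
  qed
qed

text \<open>In the dual the inversions are the pairs on which both orders of \<open>D\<close> agree,
  so the forbidden ties are those excluded by \<open>strict\<close>.\<close>

lemma fixed_D_partitions_dual_mem:
  assumes "f ` N \<subseteq> {1..n}"
  shows "f \<in> fixed_D_partitions (dual D) g \<longleftrightarrow>
    f \<in> extensional N \<and> (\<forall>x. f (g x) = f x) \<and> (\<forall>x y. (x, y) \<in> ord1 D \<longrightarrow> f y \<le> f x) \<and>
    (\<forall>j<n. strict {x\<in>N. f x = Suc j})"
proof -
  have range: "1 \<le> f x" "f x \<le> n" if "x \<in> N" for x using assms that by auto
  have less: "less1 (dual D) x y \<longleftrightarrow> less1 D y x" "less2 (dual D) x y \<longleftrightarrow> less2 D x y" for x y
    by (auto simp: less1_def less2_def dual_def)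
  have "(\<forall>j<n. strict {x\<in>N. f x = Suc j}) \<longleftrightarrow> (\<forall>i j. less1 D j i \<and> less2 D j i \<longrightarrow> f i < f j)"
    if f: "\<forall>x y. (x, y) \<in> ord1 D \<longrightarrow> f y \<le> f x"
  proof
    assume *: "\<forall>j<n. strict {x\<in>N. f x = Suc j}"
    show "\<forall>i j. less1 D j i \<and> less2 D j i \<longrightarrow> f i < f j"
    proof (intro allI impI, rule ccontr)
      fix i j assume ij: "less1 D j i \<and> less2 D j i" "\<not> f i < f j"
      then have "i \<in> N" "j \<in> N" "f i = f j"
        using f ord_sub(1) by (auto simp: less1_def intro!: antisym)
      moreover from \<open>i \<in> N\<close> obtain k where "k < n" "f i = Suc k"
        using range by (cases "f i") fastforce+
      ultimately show False using * ij(1) unfolding strict_def by auto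
    qed
  qed (fastforce simp: strict_def)
  then show ?thesis
    using range unfolding fixed_D_partitions_def D_partitions_def less
    by (auto simp: fun_eq_iff PiE_iff dual_def)
qed

text \<open>Replacing a value v by \<open>length Cs + 1 - v\<close> turns the order-reversing maps
  of the dual into order-preserving ones and reverses the list of layer sizes.\<close>

lemma card_fixed_D_partitions_dual_layered:
  "card {f \<in> fixed_D_partitions (dual D) g. f ` N \<subseteq> {1..length Cs} \<and>
      (\<forall>j<length Cs. card {x\<in>N. f x = Suc j} \<in> Cs ! j)} =
    card (layered N (map (layer_rel strict) (rev Cs)) {})" (is "card ?L = card ?R")
proof -
  let ?n = "length Cs"
  define r where "r f = (\<lambda>x\<in>N. Suc ?n - f x)" for f :: "'a \<Rightarrow> nat"
  have range: "r f x \<in> {1..?n}" if "f ` N \<subseteq> {1..?n}" "x \<in> N" for f x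
  proof -
    have "f x \<in> {1..?n}" using that by blast
    then show ?thesis using that(2) by (auto simp: r_def)
  qed
  have rr: "r (r f) = f" if "f ` N \<subseteq> {1..?n}" "f \<in> extensional N" for f
  proof
    fix x show "r (r f) x = f x"
    proof (cases "x \<in> N")
      case True
      then have "f x \<in> {1..?n}" using that by blast
      then show ?thesis using True by (simp add: r_def)
    qed (use that in \<open>simp add: r_def extensional_def\<close>)
  qed
  \<comment> \<open>Layers are numbered from \<open>0\<close> and values from \<open>1\<close>;
    layer \<open>j\<close> is exchanged with layer \<open>?n - Suc j\<close>.\<close>
  have level: "{x\<in>N. r f x = Suc j} = {x\<in>N. f x = Suc (?n - Suc j)}"
    if f: "f ` N \<subseteq> {1..?n}" and j: "j < ?n" for f j
  proof -
    have "r f x = Suc j \<longleftrightarrow> f x = Suc (?n - Suc j)" if "x \<in> N" for x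
    proof -
      have "f x \<in> {1..?n}" using f that by blast
      then show ?thesis using that j by (auto simp: r_def)
    qed
    then show ?thesis by auto
  qed
  have mono: "(\<forall>x y. (x, y) \<in> ord1 D \<longrightarrow> r f x \<le> r f y) \<longleftrightarrow> (\<forall>x y. (x, y) \<in> ord1 D \<longrightarrow> f y \<le> f x)"
    if f: "f ` N \<subseteq> {1..?n}" for f
  proof -
    have "r f x \<le> r f y \<longleftrightarrow> f y \<le> f x" if "(x, y) \<in> ord1 D" for x y
    proof -
      have "x \<in> N" "y \<in> N" using that ord_sub(1) by auto
      then have "f x \<in> {1..?n}" "f y \<in> {1..?n}" using f by blast+
      then show ?thesis using \<open>x \<in> N\<close> \<open>y \<in> N\<close> by (auto simp: r_def)
    qed
    then show ?thesis by blast
  qed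
  have inv: "(\<forall>x. r f (g x) = r f x) \<longleftrightarrow> (\<forall>x. f (g x) = f x)"
    if f: "f ` N \<subseteq> {1..?n}" "f \<in> extensional N" for f
  proof -
    have gN: "g x \<in> N \<longleftrightarrow> x \<in> N" for x using g_permutes by (simp add: permutes_in_image)
    have "r f (g x) = r f x \<longleftrightarrow> f (g x) = f x" for x
    proof (cases "x \<in> N")
      case True
      then have "f x \<in> {1..?n}" "f (g x) \<in> {1..?n}" using f(1) gN by blast+
      then show ?thesis using True gN by (auto simp: r_def)
    qed (use f(2) gN in \<open>simp add: r_def extensional_def\<close>)
    then show ?thesis by blast
  qed
  have flip: "(\<forall>j<?n. P (?n - Suc j)) \<longleftrightarrow> (\<forall>j<?n. P j)" for P
  proof -
    have "?n - Suc (?n - Suc j) = j" "?n - Suc j < ?n" if "j < ?n" for j using that by auto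
    then show ?thesis by metis
  qed
  have R: "?R = {f \<in> N \<rightarrow>\<^sub>E {1..?n}. (\<forall>x. f (g x) = f x) \<and> (\<forall>x y. (x, y) \<in> ord1 D \<longrightarrow> f x \<le> f y) \<and>
      (\<forall>j<?n. strict {x\<in>N. f x = Suc j} \<and> card {x\<in>N. f x = Suc j} \<in> Cs ! (?n - Suc j))}"
    unfolding layered_ideals_eq by (auto simp: rev_nth)
  have L: "f \<in> ?L \<longleftrightarrow> f ` N \<subseteq> {1..?n} \<and> f \<in> extensional N \<and> (\<forall>x. f (g x) = f x) \<and>
      (\<forall>x y. (x, y) \<in> ord1 D \<longrightarrow> f y \<le> f x) \<and>
      (\<forall>j<?n. strict {x\<in>N. f x = Suc j} \<and> card {x\<in>N. f x = Suc j} \<in> Cs ! j)" for f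
    using fixed_D_partitions_dual_mem[of f ?n] by auto
  have r_ext: "r f \<in> extensional N" for f by (simp add: r_def)
  have key: "r f \<in> ?R \<longleftrightarrow> f \<in> ?L" if f: "f ` N \<subseteq> {1..?n}" "f \<in> extensional N" for f
  proof -
    have "(\<forall>j<?n. strict {x\<in>N. r f x = Suc j} \<and> card {x\<in>N. r f x = Suc j} \<in> Cs ! (?n - Suc j)) \<longleftrightarrow>
      (\<forall>j<?n. strict {x\<in>N. f x = Suc (?n - Suc j)} \<and>
        card {x\<in>N. f x = Suc (?n - Suc j)} \<in> Cs ! (?n - Suc j))"
      using level[OF f(1)] by simp
    also have "\<dots> \<longleftrightarrow> (\<forall>j<?n. strict {x\<in>N. f x = Suc j} \<and> card {x\<in>N. f x = Suc j} \<in> Cs ! j)"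
      by (rule flip)
    finally have levels: "(\<forall>j<?n. strict {x\<in>N. r f x = Suc j} \<and> card {x\<in>N. r f x = Suc j} \<in> Cs ! (?n - Suc j)) \<longleftrightarrow>
      (\<forall>j<?n. strict {x\<in>N. f x = Suc j} \<and> card {x\<in>N. f x = Suc j} \<in> Cs ! j)" .
    have "r f \<in> N \<rightarrow>\<^sub>E {1..?n}" using range[OF f(1)] r_ext by (auto simp: PiE_iff)
    then show ?thesis unfolding L R mem_Collect_eq inv[OF f] mono[OF f(1)] levels using f by blast
  qed
  have R_range: "f ` N \<subseteq> {1..?n} \<and> f \<in> extensional N" if "f \<in> ?R" for f
    using that unfolding R by (auto simp: PiE_iff)
  have r_range: "r f ` N \<subseteq> {1..?n}" if "f ` N \<subseteq> {1..?n}" for f using range[OF that] by blast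
  have "bij_betw r ?L ?R"
  proof (rule bij_betw_byWitness[where f' = r])
    show "\<forall>f\<in>?L. r (r f) = f" using rr L by blast
    show "\<forall>f\<in>?R. r (r f) = f" using rr R_range by blast
    show "r ` ?L \<subseteq> ?R" using key L by blast
    show "r ` ?R \<subseteq> ?L"
    proof (rule image_subsetI)
      fix f assume f: "f \<in> ?R"
      then have "r (r f) \<in> ?R" using rr R_range by metis
      then show "r f \<in> ?L" using key[of "r f"] r_range r_ext R_range[OF f] by blast
    qed
  qed
  then show ?thesis by (rule bij_betw_same_card)
qed

section \<open>Coefficients of the invariants and the antipode identity\<close>

lemma monomial_of_eq_packed:
  assumes "composition \<alpha>" "f ` N \<subseteq> {1..}"
  shows "monomial_of D f = packed \<alpha> \<longleftrightarrow>
    f ` N \<subseteq> {1..length \<alpha>} \<and> (\<forall>j<length \<alpha>. card {x\<in>N. f x = Suc j} \<in> map (\<lambda>a. {a}) \<alpha> ! j)"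
proof -
  have count: "count (monomial_of D f) y = card {x\<in>N. f x = y}" for y
  proof -
    have "f -` {y} \<inter> N = {x\<in>N. f x = y}" by auto
    then show ?thesis using finite_points by (simp add: monomial_of_def count_image_mset)
  qed
  show ?thesis
  proof
    assume eq: "monomial_of D f = packed \<alpha>"
    have "f ` N = set_mset (monomial_of D f)" using finite_points by (simp add: monomial_of_def)
    then have "f ` N = {1..length \<alpha>}" using eq set_packed[OF assms(1)] by simp
    moreover have "card {x\<in>N. f x = Suc j} = \<alpha> ! j" if "j < length \<alpha>" for j
      using that by (simp add: count[symmetric] eq count_packed)
    ultimately show "f ` N \<subseteq> {1..length \<alpha>} \<and>
      (\<forall>j<length \<alpha>. card {x\<in>N. f x = Suc j} \<in> map (\<lambda>a. {a}) \<alpha> ! j)" by simp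
  next
    assume f: "f ` N \<subseteq> {1..length \<alpha>} \<and>
      (\<forall>j<length \<alpha>. card {x\<in>N. f x = Suc j} \<in> map (\<lambda>a. {a}) \<alpha> ! j)"
    show "monomial_of D f = packed \<alpha>"
    proof (rule multiset_eqI)
      fix y
      show "count (monomial_of D f) y = count (packed \<alpha>) y"
      proof (cases "1 \<le> y \<and> y \<le> length \<alpha>")
        case True
        then show ?thesis using f by (cases y) (simp_all add: count count_packed)
      next
        case False
        then have "{x\<in>N. f x = y} = {}" using f by fastforce
        then show ?thesis using False by (simp only: count count_packed) auto
      qed
    qed
  qed
qed

lemma points_dual: "points (dual D) = N"
  by (simp add: dual_def)

lemma monomial_of_dual: "monomial_of (dual D) = monomial_of D"
  by (simp add: monomial_of_def fun_eq_iff points_dual)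

lemma double_poset_dual: "double_poset (dual D)"
  using D by (simp add: double_poset_def dual_def)

lemma fixed_D_partitions_pos:
  "f \<in> fixed_D_partitions D g \<Longrightarrow> f ` N \<subseteq> {1..}"
  "f \<in> fixed_D_partitions (dual D) g \<Longrightarrow> f ` N \<subseteq> {1..}"
  by (auto simp: fixed_D_partitions_def D_partitions_def points_dual PiE_iff)

lemma M_coeff_Omega:
  assumes \<alpha>: "composition \<alpha>"
  shows "M_coeff (Omega D g) \<alpha> = (foldr (\<lambda>a. sum_layers weak {a}) \<alpha> delta {} :: 'k::field_char_0)"
proof -
  have "{f \<in> fixed_D_partitions D g. monomial_of D f = packed \<alpha>} =
      layered N (map (layer_rel weak) (map (\<lambda>a. {a}) \<alpha>)) {}"
    unfolding fixed_D_partitions_layered[symmetric] length_map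
    using monomial_of_eq_packed[OF \<alpha>] fixed_D_partitions_pos(1) by blast
  then show ?thesis
    unfolding M_coeff_def Omega_def
    using foldr_sum_layers_delta[of "{}" weak "map (\<lambda>a. {a}) \<alpha>", where 'k = 'k]
    by (simp add: foldr_map o_def)
qed

lemma M_coeff_Omega_dual:
  assumes \<alpha>: "composition \<alpha>"
  shows "M_coeff (Omega (dual D) g) \<alpha> =
    (foldr (\<lambda>a. sum_layers strict {a}) (rev \<alpha>) delta {} :: 'k::field_char_0)"
proof -
  have "{f \<in> fixed_D_partitions (dual D) g. monomial_of (dual D) f = packed \<alpha>} =
    {f \<in> fixed_D_partitions (dual D) g. f ` N \<subseteq> {1..length (map (\<lambda>a. {a}) \<alpha>)} \<and>
      (\<forall>j<length (map (\<lambda>a. {a}) \<alpha>). card {x\<in>N. f x = Suc j} \<in> map (\<lambda>a. {a}) \<alpha> ! j)}"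
    unfolding length_map monomial_of_dual
    using monomial_of_eq_packed[OF \<alpha>] fixed_D_partitions_pos(2) by blast
  then show ?thesis
    unfolding M_coeff_def Omega_def
    using foldr_sum_layers_delta[of "{}" strict "rev (map (\<lambda>a. {a}) \<alpha>)", where 'k = 'k]
      card_fixed_D_partitions_dual_layered[of "map (\<lambda>a. {a}) \<alpha>"]
    by (simp add: foldr_map o_def rev_map)
qed

lemma eps_points: "eps N = ((-1) ^ card N * of_int (sign g) :: 'k::field_char_0)"
  by (simp add: eps_def sign_on_permutes[OF g_permutes])

lemma QSym_packed_exponents:
  assumes "F \<in> QSym" "0 \<notin># m" shows "M_coeff F (exponents m) = F m"
  using assms zero_not_in_packed exponents_packed[OF composition_exponents]
  unfolding QSym_def mem_Collect_eq M_coeff_def by metis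

lemma Omega_dual_in_QSym: "(Omega (dual D) g :: 'k::field_char_0 series) \<in> QSym"
  using g finite_points by (intro Omega_in_QSym double_poset_dual) (simp_all add: points_dual Aut_dual)

text \<open>The alternating sum of \<open>antipode_coeff\<close> is a product of graded pieces of
  \<open>B\<close> applied to \<open>delta\<close>, hence \<open>eps N\<close> times a number of
  strict chains. The reversal in the antipode matches the one from reading dual partitions from the
  top, and \<open>eps N\<close> squares to 1.\<close>

lemma antipode_Omega:
  "(-1) ^ card N * of_int (sign g) * antipode (Omega D g) m = (Omega (dual D) g m :: 'k::field_char_0)"
proof (cases "0 \<in># m")
  case True
  then have "antipode (Omega D g) m = (0 :: 'k)"
    by (simp add: antipode_def antipode_M_def M_def)
  moreover have "Omega (dual D) g m = (0 :: 'k)"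
    using Omega_dual_in_QSym[where 'k = 'k] True by (simp add: QSym_def)
  ultimately show ?thesis by simp
next
  case False
  define \<beta> where "\<beta> = exponents m"
  have \<beta>: "composition \<beta>" "composition (rev \<beta>)"
    using composition_exponents by (auto simp: \<beta>_def composition_def)
  have "antipode (Omega D g) m =
      (\<Sum>\<alpha>\<in>refinements (rev \<beta>). (-1) ^ length \<alpha> * M_coeff (Omega D g) \<alpha> :: 'k)"
    unfolding \<beta>_def by (rule antipode_coeff[OF Omega_in_QSym[OF D finite_points g] False])
  also have "\<dots> = (\<Sum>\<alpha>\<in>refinements (rev \<beta>).
      (-1) ^ length \<alpha> * foldr (\<lambda>a. sum_layers weak {a}) \<alpha> delta {})"
    by (rule sum.cong) (simp_all add: refinements_def M_coeff_Omega)
  also have "\<dots> = foldr (\<lambda>b. signed_layers {b}) (rev \<beta>) delta {}"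
    by (rule foldr_signed_layers_refinements[OF \<beta>(2) empty_ideal])
  also have "\<dots> = eps N * foldr (\<lambda>b. sum_layers strict {b}) (rev \<beta>) delta {}"
    using foldr_signed_layers_delta[OF empty_ideal, of "map (\<lambda>b. {b}) (rev \<beta>)", where 'k = 'k]
    by (simp add: foldr_map o_def)
  also have "\<dots> = eps N * M_coeff (Omega (dual D) g) \<beta>"
    by (simp only: M_coeff_Omega_dual[OF \<beta>(1)])
  also have "\<dots> = eps N * Omega (dual D) g m"
    by (simp only: \<beta>_def QSym_packed_exponents[OF Omega_dual_in_QSym False])
  finally show ?thesis
    by (simp add: eps_points[symmetric] mult.assoc[symmetric] eps_square)
qed

section \<open>The polynomial at negative integers\<close>

text \<open>The off-diagonal part \<open>A - 1\<close>.\<close>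

definition sum_proper_layers :: "('a set \<Rightarrow> 'k::field_char_0) \<Rightarrow> 'a set \<Rightarrow> 'k" where
  "sum_proper_layers \<phi> I = (\<Sum>K\<in>ideals. of_bool (I \<noteq> K \<and> layer weak UNIV I K) * \<phi> K)"

lemma sum_layers_proper:
  assumes "I \<in> ideals"
  shows "sum_layers weak UNIV \<phi> I = \<phi> I + sum_proper_layers \<phi> I"
proof -
  have "sum_layers weak UNIV \<phi> I = (\<Sum>K\<in>ideals. (if K = I then \<phi> K else 0) +
      of_bool (I \<noteq> K \<and> layer weak UNIV I K) * \<phi> K)"
    unfolding sum_layers_def by (rule sum.cong) (auto simp: layer_def weak_empty)
  then show ?thesis using assms finite_ideals by (simp add: sum.distrib sum_proper_layers_def)
qed

lemma card_complement_less:
  assumes "K \<in> ideals" "I \<noteq> K" "layer weak UNIV I K"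
  shows "card (N - K) < card (N - I)"
  using assms finite_points by (intro psubset_card_mono) (auto simp: ideals_def layer_def)

text \<open>Every proper step makes the complement in \<open>N\<close> smaller, so a chain from
  \<open>I\<close> has at most \<open>card (N - I)\<close> of them.\<close>

lemma sum_proper_layers_nilpotent:
  "I \<in> ideals \<Longrightarrow> card (N - I) < k \<Longrightarrow> (sum_proper_layers ^^ k) \<phi> I = 0"
proof (induction k arbitrary: I)
  case (Suc k)
  have "of_bool (I \<noteq> K \<and> layer weak UNIV I K) * (sum_proper_layers ^^ k) \<phi> K = 0"
    if K: "K \<in> ideals" for K
  proof (cases "I \<noteq> K \<and> layer weak UNIV I K")
    case True
    then have "card (N - K) < k" using card_complement_less[OF K, of I] Suc.prems(2) by linarith
    then show ?thesis by (simp add: Suc.IH[OF K])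
  qed (simp only: of_bool_eq mult_zero_left)
  then show ?case by (simp add: sum_proper_layers_def[of "(sum_proper_layers ^^ k) \<phi>"] sum.neutral)
qed simp

text \<open>\<open>A\<close> is unitriangular: its off-diagonal entries involve only larger ideals,
  where \<open>\<phi>\<close> and \<open>\<psi>\<close> agree by induction.\<close>

lemma sum_layers_weak_inject:
  assumes "\<And>I. I \<in> ideals \<Longrightarrow> sum_layers weak UNIV \<phi> I = sum_layers weak UNIV \<psi> I"
  shows "I \<in> ideals \<Longrightarrow> \<phi> I = \<psi> I"
proof (induction "card (N - I)" arbitrary: I rule: less_induct)
  case less
  have "sum_proper_layers \<phi> I = sum_proper_layers \<psi> I"
    unfolding sum_proper_layers_def
    by (rule sum.cong[OF refl]) (use less.hyps card_complement_less in auto)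
  then show ?case using assms[OF less.prems] by (simp add: sum_layers_proper[OF less.prems])
qed

text \<open>The power of \<open>A\<close> with exponent \<open>x\<close>, applied to
  \<open>delta\<close>, through the binomial series of \<open>1 + (A - 1)\<close>; nilpotency
  permits the cut at \<open>card N\<close>.\<close>

definition layer_power :: "'k::field_char_0 \<Rightarrow> 'a set \<Rightarrow> 'k" where
  "layer_power x I = (\<Sum>k\<le>card N. (sum_proper_layers ^^ k) delta I * (x gchoose k))"

text \<open>Multiplying by \<open>A\<close> raises the exponent by one; on the binomial coefficients
  this is Pascal's rule.\<close>

lemma sum_layers_layer_power:
  fixes x :: "'k::field_char_0"
  assumes I: "I \<in> ideals"
  shows "sum_layers weak UNIV (layer_power x) I = layer_power (x + 1) I"
proof -
  define c :: "nat \<Rightarrow> 'k" where "c k = (sum_proper_layers ^^ k) delta I" for k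
  \<comment> \<open>The index shift creates a term beyond the cut, which nilpotency removes.\<close>
  have "c (Suc (card N)) = 0"
    unfolding c_def using I finite_points
    by (intro sum_proper_layers_nilpotent) (auto intro!: le_imp_less_Suc card_mono)
  then have last: "(\<Sum>k\<le>card N. c (Suc k) * (x gchoose k)) = (\<Sum>k<card N. c (Suc k) * (x gchoose k))"
    by (simp add: lessThan_Suc_atMost[symmetric])
  have "sum_proper_layers (layer_power x) I = (\<Sum>K\<in>ideals. \<Sum>k\<le>card N.
      of_bool (I \<noteq> K \<and> layer weak UNIV I K) * (sum_proper_layers ^^ k) delta K * (x gchoose k))"
    unfolding sum_proper_layers_def[of "layer_power x"] layer_power_def sum_distrib_left mult.assoc ..
  also have "\<dots> = (\<Sum>k\<le>card N. c (Suc k) * (x gchoose k))"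
    by (subst sum.swap)
      (simp add: c_def sum_proper_layers_def[of "(sum_proper_layers ^^ _) delta"] sum_distrib_right)
  finally have "sum_layers weak UNIV (layer_power x) I =
      (\<Sum>k\<le>card N. c k * (x gchoose k)) + (\<Sum>k<card N. c (Suc k) * (x gchoose k))"
    using sum_layers_proper[OF I, of "layer_power x"] last by (simp add: layer_power_def c_def)
  also have "\<dots> = c 0 + (\<Sum>k<card N. c (Suc k) * ((x gchoose k) + (x gchoose Suc k)))"
    by (simp add: sum.atMost_shift sum.distrib algebra_simps)
  also have "\<dots> = (\<Sum>k\<le>card N. c k * (x + 1 gchoose k))"
    by (simp add: sum.atMost_shift gbinomial_Suc_Suc)
  finally show ?thesis by (simp add: layer_power_def c_def)
qed

lemma layer_power_0: "layer_power 0 I = delta I"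
proof -
  have "layer_power 0 I = (\<Sum>k\<le>card N. if k = 0 then (sum_proper_layers ^^ k) delta I else 0 :: 'b)"
    unfolding layer_power_def by (rule sum.cong) (auto simp: gbinomial_0_left)
  then show ?thesis by simp
qed

lemma layer_power_of_nat:
  "I \<in> ideals \<Longrightarrow>
    layer_power (of_nat n) I = (foldr (sum_layers weak) (replicate n UNIV) delta I :: 'k::field_char_0)"
proof (induction n arbitrary: I)
  case (Suc n)
  have "layer_power (of_nat (Suc n)) I = (sum_layers weak UNIV (layer_power (of_nat n)) I :: 'k)"
    by (simp add: sum_layers_layer_power[OF Suc.prems] add.commute)
  also have "\<dots> = sum_layers weak UNIV (foldr (sum_layers weak) (replicate n UNIV) delta) I"
    by (rule sum_layers_cong) (rule Suc.IH)
  finally show ?case by simp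
qed (simp add: layer_power_0)

text \<open>Applying \<open>A\<close> to either side at \<open>Suc n\<close> gives the two sides at
  \<open>n\<close>, and \<open>A\<close> is injective on vectors over ideals.\<close>

lemma layer_power_minus_of_nat:
  "I \<in> ideals \<Longrightarrow>
    layer_power (- of_nat n) I = (foldr signed_layers (replicate n UNIV) delta I :: 'k::field_char_0)"
proof (induction n arbitrary: I)
  case (Suc n)
  show ?case
  proof (rule sum_layers_weak_inject[OF _ Suc.prems])
    fix J assume J: "J \<in> ideals"
    show "sum_layers weak UNIV (layer_power (- of_nat (Suc n) :: 'k)) J =
      sum_layers weak UNIV (foldr signed_layers (replicate (Suc n) UNIV) delta) J"
      using Suc.IH[OF J] by (simp add: sum_layers_layer_power[OF J] sum_layers_signed_layers_UNIV[OF J])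
  qed
qed (simp add: layer_power_0)

text \<open>The binomial expansion makes the right-hand side a polynomial in \<open>x\<close>, and
  at positive integers both sides count weak chains from \<open>{}\<close> to
  \<open>N\<close>.\<close>

lemma poly_Omega_poly: "poly (Omega_poly D g) x = (layer_power x {} :: 'k::field_char_0)"
proof -
  define b :: "nat \<Rightarrow> 'k poly" where
    "b k = smult (inverse (fact k)) (\<Prod>i=0..<k. [:- of_nat i, 1:])" for k
  have b: "poly (b k) x = x gchoose k" for k x
    by (simp add: b_def poly_prod gbinomial_prod_rev field_simps)
  define p where "p = (\<Sum>k\<le>card N. smult ((sum_proper_layers ^^ k) delta {}) (b k))"
  have p: "poly p x = layer_power x {}" for x
    by (simp add: p_def poly_sum b layer_power_def)
  have "Omega_poly D g = p"
  proof (rule Omega_poly_unique)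
    fix n :: nat assume n: "n \<ge> 1"
    have "{f \<in> fixed_D_partitions D g. f ` N \<subseteq> {1..n}} =
        layered N (map (layer_rel weak) (replicate n UNIV)) {}"
      unfolding fixed_D_partitions_layered[symmetric] by auto
    then show "poly (Omega_poly D g) (of_nat n) = poly p (of_nat n)"
      unfolding p layer_power_of_nat[OF empty_ideal] Omega_poly_eval[OF D finite_points g n]
        foldr_sum_layers_delta[OF empty_subsetI] by simp
  qed
  then show ?thesis by (simp add: p)
qed

text \<open>It suffices to compare values at positive \<open>n\<close>. There the power of
  \<open>A\<close> with exponent \<open>- n\<close> is the \<open>n\<close>-th power of
  \<open>B\<close>, whose entry from \<open>{}\<close> to \<open>N\<close> is \<open>eps N\<close>
  times the number of strict chains, i.e. of dual partitions.\<close>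

lemma Omega_poly_reciprocity:
  "smult ((-1) ^ card N * of_int (sign g)) (pcompose (Omega_poly D g) [:0, -1:]) =
    (Omega_poly (dual D) g :: 'k::field_char_0 poly)"
proof (rule Omega_poly_unique)
  fix n :: nat assume n: "n \<ge> 1"
  have "poly (Omega_poly (dual D) g) (of_nat n) =
      (of_nat (card {f \<in> fixed_D_partitions (dual D) g. f ` N \<subseteq> {1..n}}) :: 'k)"
    using Omega_poly_eval[OF double_poset_dual, of g n] g finite_points n
    by (simp add: points_dual Aut_dual)
  also have "card {f \<in> fixed_D_partitions (dual D) g. f ` N \<subseteq> {1..n}} =
      card (layered N (map (layer_rel strict) (replicate n UNIV)) {})"
    using card_fixed_D_partitions_dual_layered[of "replicate n UNIV"] by simp
  also have "of_nat \<dots> = (foldr (sum_layers strict) (replicate n UNIV) delta {} :: 'k)"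
    by (simp only: foldr_sum_layers_delta[OF empty_subsetI])
  \<comment> \<open>The factor 1 is written as a square of \<open>eps N\<close>; one copy turns the
    strict count into a power of \<open>B\<close>, the other is the sign in the claim.\<close>
  also have "\<dots> = eps N * (eps N * foldr (sum_layers strict) (replicate n UNIV) delta {})"
    by (simp only: mult.assoc[symmetric] eps_square mult_1)
  also have "eps N * foldr (sum_layers strict) (replicate n UNIV) delta {} =
      (layer_power (- of_nat n) {} :: 'k)"
    using foldr_signed_layers_delta[OF empty_ideal, of "replicate n UNIV", where 'k = 'k]
    by (simp only: layer_power_minus_of_nat[OF empty_ideal] Diff_empty)
  finally show "poly (smult ((-1) ^ card N * of_int (sign g)) (pcompose (Omega_poly D g) [:0, -1:])) (of_nat n) =
      poly (Omega_poly (dual D) g) (of_nat n :: 'k)"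
    by (simp add: poly_pcompose poly_Omega_poly eps_points)
qed

end

theorem theorem5p1:
  fixes D :: "'a double_poset" and G :: "('a \<Rightarrow> 'a) set"
  assumes "double_poset D" and "finite (points D)" and "locally_special D"
    and "G \<subseteq> Aut D"
  shows "(\<forall>g\<in>G. (\<lambda>m. (-1) ^ card (points D) * of_int (sign g) * antipode (Omega D g) m)
             = (Omega (dual D) g :: ('k::field_char_0) series)) \<and>
         (\<forall>g\<in>G. smult ((-1) ^ card (points D) * of_int (sign g)) (pcompose (Omega_poly D g) [:0, -1:])
             = (Omega_poly (dual D) g :: 'k poly))"
proof -
  have "double_poset_automorphism D g" if "g \<in> G" for g
    using assms that by unfold_locales auto
  then show ?thesis
    by (simp add: double_poset_automorphism.antipode_Omega
        double_poset_automorphism.Omega_poly_reciprocity)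
qed

end
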